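(* Suppose $\{\mathcal{F}_J\}_{J\in\mathbb{N}}$ is a coherent sequence of uniform covering frames on $\mathbb{R}^d$, with index sets $\Lambda_J$, output-generating functions $g_{0,J}$, and path sets $P_J:=\bigcup_{k=0}^\infty\Lambda_J^k$. Let $\tilde{S}_{\mathcal{F}_J}$ be the corresponding Fourier scattering transforms. Then, for every $f\in L^2(\mathbb{R}^d)$ and every $c\in\mathbb{R}^d$, $$\lim_{J\to\infty}\left\|\tilde{S}_{\mathcal{F}_J}[P_J]f-\tilde{S}_{\mathcal{F}_J}[P_J]T_cf\right\|_{L^2l^2}=0.$$
   Context: Functions are complex-valued on $\mathbb{R}^d$. The Fourier transform is normalized as $\hat{f}(\xi)=\int_{\mathbb{R}^d}f(x)e^{-2\pi i x\cdot\xi}\,dx$ (extended to $L^2$ by Plancherel). Translation: $(T_cf)(x):=f(x-c)$. A semi-discrete Bessel sequence is a sequence (countable family) $\mathcal{G}$ of functions in $L^1(\mathbb{R}^d)\cap L^2(\mathbb{R}^d)$ with $\sum_{g\in\mathcal{G}}|\hat{g}(\xi)|^2\leq 1$ for a.e. $\xi$. If $\mathcal{G}=\{g_\lambda\}_{\lambda\in\Lambda}\cup\{g_0\}$ for a set $\Lambda$ with $0\notin\Lambda$, we say $\mathcal{G}$ has index set $\Lambda$ and output-generating function $g_0$. Uniform covering frame: a semi-discrete Bessel sequence $\mathcal{F}=\{g_0\}\cup\{g_\lambda:\lambda\in\Lambda\}$ such that (1) $g_0\in L^1\cap L^2$, $\hat{g}_0$ is supported in a neighborhood of the origin and $|\hat{g}_0(0)|=1$,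 and for each $\lambda\in\Lambda$, $g_\lambda\in L^1\cap L^2$ and $\operatorname{supp}(\hat{g}_\lambda)$ is compact and connected; (2) there exists $R$ such that for each $\lambda\in\Lambda$ there is $\xi_\lambda\in\mathbb{R}^d$ with $\operatorname{supp}(\hat{g}_\lambda)$ contained in the open ball of radius $R$ centered at $\xi_\lambda$; (3) $|\hat{g}_0(\xi)|^2+\sum_{\lambda\in\Lambda}|\hat{g}_\lambda(\xi)|^2=1$ for all $\xi\in\mathbb{R}^d$. Scattering propagator: for $p=(\lambda_1,\dots,\lambda_k)\in\Lambda^k$ and $f\in L^2(\mathbb{R}^d)$, define inductively $\tilde{U}[p]f:=f$ if $k=0$ (the empty path), and $\tilde{U}[p]f:=\left|\tilde{U}[\lambda_1,\dots,\lambda_{k-1}]f*g_{\lambda_k}\right|$ if $k\geq1$. Fourier scattering transform of a uniform covering frame $\mathcal{F}$: with $P:=\bigcup_{n=0}^\infty\Lambda^n$, $\tilde{S}_{\mathcal{F}}[P]f:=\{\tilde{U}[p]f*g_0\}_{p\in P}$. For a family $\{h_p\}_{p\in P}$ of $L^2$ functions, $\|\{h_p\}\|_{L^2l^2}^2:=\sum_{p\in P}\|h_p\|_{L^2}^2$; differences of such families are taken entrywise. Coherent: a sequence $\{\mathcal{F}_J\}_{J\in\mathbb{N}}$ of semi-discrete Bessel sequences (here uniform covering frames) with index sets $\Lambda_J$ and output-generating functions $g_{0,J}$, such that $\hat{g}_{0,J}$ is compactly supported for each $J$, is coherent if (1) $\mathcal{F}_J\setminus\{g_{0,J}\}\subseteq\mathcal{F}_{J+1}\setminus\{g_{0,J+1}\}$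 for each $J$ (with index sets chosen consistently, so that $\Lambda_J\subseteq\Lambda_{J+1}$), and (2) $\lim_{J\to\infty}\sup\{|\xi| : \hat{g}_{0,J}(\xi)\neq0\}=0$. *)

theory Defs
  imports "HOL-Analysis.Analysis"
begin

text \<open>
  Euclidean space is an arbitrary type of class \<^class>\<open>euclidean_space\<close>. Elements of \<open>L\<^sup>1\<close> and
  \<open>L\<^sup>2\<close> are represented by Lebesgue measurable functions; no quotient by null sets is formed.
\<close>

definition L1 :: "('a::euclidean_space \<Rightarrow> complex) set" where
  "L1 = {f. integrable lebesgue f}"

definition L2 :: "('a::euclidean_space \<Rightarrow> complex) set" where
  "L2 = {f. f \<in> borel_measurable lebesgue \<and> integrable lebesgue (\<lambda>x. (cmod (f x))\<^sup>2)}"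

text \<open>Used below only for functions in \<open>L\<^sup>1\<close>, so the Plancherel extension is not needed.\<close>

definition fourier :: "('a::euclidean_space \<Rightarrow> complex) \<Rightarrow> 'a \<Rightarrow> complex" where
  "fourier f \<xi> = (LINT x|lebesgue. f x * exp (- (2 * of_real pi * \<i> * of_real (x \<bullet> \<xi>))))"

definition supp :: "('a::euclidean_space \<Rightarrow> complex) \<Rightarrow> 'a set" where
  "supp f = closure {x. f x \<noteq> 0}"

definition translation :: "'a::euclidean_space \<Rightarrow> ('a \<Rightarrow> complex) \<Rightarrow> 'a \<Rightarrow> complex" where
  "translation c f = (\<lambda>x. f (x - c))"

text \<open>For \<open>f\<close> and \<open>g\<close> in \<open>L\<^sup>2\<close> the integrand below is integrable for every \<open>x\<close>.\<close>

definition convol ::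
    "('a::euclidean_space \<Rightarrow> complex) \<Rightarrow> ('a \<Rightarrow> complex) \<Rightarrow> 'a \<Rightarrow> complex" where
  "convol f g x = (LINT y|lebesgue. f y * g (x - y))"

text \<open>
  A family with index set \<open>\<Lambda>\<close> and output-generating function \<open>g0\<close> is given by the triple
  \<open>\<Lambda>\<close>, \<open>g\<close>, \<open>g0\<close>. Since \<open>g0\<close> is kept apart from \<open>g\<close>, the extra index \<open>0\<close> outside \<open>\<Lambda>\<close> is not needed.
\<close>

definition semi_discrete_bessel ::
    "'i set \<Rightarrow> ('i \<Rightarrow> 'a::euclidean_space \<Rightarrow> complex) \<Rightarrow> ('a \<Rightarrow> complex) \<Rightarrow> bool" where
  "semi_discrete_bessel \<Lambda> g g0 \<longleftrightarrow>
     countable \<Lambda> \<and> g0 \<in> L1 \<inter> L2 \<and> (\<forall>l\<in>\<Lambda>. g l \<in> L1 \<inter> L2) \<and>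
     (AE \<xi> in lebesgue.
        ennreal ((cmod (fourier g0 \<xi>))\<^sup>2) + (\<Sum>\<^sub>\<infinity>l\<in>\<Lambda>. ennreal ((cmod (fourier (g l) \<xi>))\<^sup>2)) \<le> 1)"

text \<open>
  ``Supported in a neighborhood of the origin'' is read as supported in some bounded
  neighborhood; with unbounded neighborhoods the condition would be vacuous.
\<close>

definition uniform_covering_frame ::
    "'i set \<Rightarrow> ('i \<Rightarrow> 'a::euclidean_space \<Rightarrow> complex) \<Rightarrow> ('a \<Rightarrow> complex) \<Rightarrow> bool" where
  "uniform_covering_frame \<Lambda> g g0 \<longleftrightarrow>
     semi_discrete_bessel \<Lambda> g g0 \<and>
     (\<exists>r>0. supp (fourier g0) \<subseteq> ball 0 r) \<and> cmod (fourier g0 0) = 1 \<and>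
     (\<forall>l\<in>\<Lambda>. compact (supp (fourier (g l))) \<and> connected (supp (fourier (g l)))) \<and>
     (\<exists>R. \<forall>l\<in>\<Lambda>. \<exists>\<xi>l. supp (fourier (g l)) \<subseteq> ball \<xi>l R) \<and>
     (\<forall>\<xi>. ennreal ((cmod (fourier g0 \<xi>))\<^sup>2)
           + (\<Sum>\<^sub>\<infinity>l\<in>\<Lambda>. ennreal ((cmod (fourier (g l) \<xi>))\<^sup>2)) = 1)"

text \<open>
  The inclusion of the families without their output-generating functions is expressed through
  consistently chosen index sets; members are compared as elements of \<open>L\<^sup>1 \<inter> L\<^sup>2\<close>, i.e. almost
  everywhere. The real supremum is meaningful because the supports are compact, and nonempty
  for uniform covering frames.
\<close>

definition coherent ::
    "(nat \<Rightarrow> 'i set) \<Rightarrow> (nat \<Rightarrow> 'i \<Rightarrow> 'a::euclidean_space \<Rightarrow> complex)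
      \<Rightarrow> (nat \<Rightarrow> 'a \<Rightarrow> complex) \<Rightarrow> bool" where
  "coherent \<Lambda> g g0 \<longleftrightarrow>
     (\<forall>J. semi_discrete_bessel (\<Lambda> J) (g J) (g0 J)) \<and>
     (\<forall>J. compact (supp (fourier (g0 J)))) \<and>
     (\<forall>J. \<Lambda> J \<subseteq> \<Lambda> (Suc J) \<and> (\<forall>l\<in>\<Lambda> J. AE x in lebesgue. g (Suc J) l x = g J l x)) \<and>
     (\<lambda>J. Sup {norm \<xi> | \<xi>. fourier (g0 J) \<xi> \<noteq> 0}) \<longlonglongrightarrow> 0"

text \<open>A path \<open>(l\<^sub>1, \<dots>, l\<^sub>k)\<close> is the list \<open>[l\<^sub>1, \<dots>, l\<^sub>k]\<close>; the filter of \<open>l\<^sub>1\<close> is applied first.\<close>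

definition paths :: "'i set \<Rightarrow> 'i list set" where
  "paths \<Lambda> = (\<Union>k. {p. length p = k \<and> set p \<subseteq> \<Lambda>})"

definition propagator ::
    "('i \<Rightarrow> 'a::euclidean_space \<Rightarrow> complex) \<Rightarrow> 'i list \<Rightarrow> ('a \<Rightarrow> complex) \<Rightarrow> 'a \<Rightarrow> complex" where
  "propagator g p f = foldl (\<lambda>h l x. of_real (cmod (convol h (g l) x))) f p"

lemma propagator_Nil [simp]: "propagator g [] f = f"
  by (simp add: propagator_def)

lemma propagator_snoc [simp]:
  "propagator g (p @ [l]) f = (\<lambda>x. of_real (cmod (convol (propagator g p f) (g l) x)))"
  by (simp add: propagator_def)

definition scattering ::
    "('i \<Rightarrow> 'a::euclidean_space \<Rightarrow> complex) \<Rightarrow> ('a \<Rightarrow> complex) \<Rightarrow> ('a \<Rightarrow> complex)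
      \<Rightarrow> 'i list \<Rightarrow> 'a \<Rightarrow> complex" where
  "scattering g g0 f p = convol (propagator g p f) g0"

text \<open>The norm is extended-valued, so its convergence to \<open>0\<close> includes eventual finiteness.\<close>

definition L2l2_norm :: "'p set \<Rightarrow> ('p \<Rightarrow> 'a::euclidean_space \<Rightarrow> complex) \<Rightarrow> ennreal" where
  "L2l2_norm P h =
     (let s = \<Sum>\<^sub>\<infinity>p\<in>P. \<integral>\<^sup>+ x. ennreal ((cmod (h p x))\<^sup>2) \<partial>lebesgue
      in if s = \<infinity> then \<infinity> else ennreal (sqrt (enn2real s)))"

end

theory Submission
  imports Defs "HOL-Probability.Characteristic_Functions"
begin

text \<open>
  The propagator commutes with translations, so the entry at \<open>p\<close> of the difference is the convolution
  of \<open>U[p]f\<close> with \<open>g\<^sub>0 - T\<^sub>c g\<^sub>0\<close>. The Fourier transform of this filter is that of \<open>g\<^sub>0\<close> times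
  \<open>1 - exp (-2\<pi>i c\<bullet>\<xi>)\<close>, hence at most \<open>\<epsilon> = 2\<pi>|c|r\<close> times that of \<open>g\<^sub>0\<close> if the latter vanishes outside the
  ball of radius \<open>r\<close>. Therefore \<open>(g\<^sub>0 - T\<^sub>c g\<^sub>0) / \<epsilon>\<close> together with the \<open>g\<^sub>\<lambda>\<close> is again a Bessel family, and
  energy conservation along the tree of paths bounds the norm of the difference by \<open>\<epsilon> \<parallel>f\<parallel>\<close>. No decay
  of the energy with the path length is needed. Plancherel's identity is required only for bounded
  continuous integrable functions, where it follows from Gaussian summation; Fatou's lemma then
  extends the energy inequality for Bessel families to all of \<open>L\<^sup>2\<close>.
\<close>

section \<open>Reflections and translations of Lebesgue measure\<close>

text \<open>The Jacobian is the product of \<open>\<bar>c\<bar>\<close> over the basis, hence 1.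
  Reflections and shifts are the cases c = -1 and c = 1. Measurability has to be shown for the
  completed measure on both sides, which Borel measurability of the map alone does not give.\<close>

lemma distr_lebesgue_isometry:
  fixes t :: "'a::euclidean_space"
  assumes "\<bar>c\<bar> = 1"
  shows "distr lebesgue lebesgue (\<lambda>x. t + c *\<^sub>R x) = lebesgue"
    and "(\<lambda>x. t + c *\<^sub>R x) \<in> lebesgue \<rightarrow>\<^sub>M lebesgue"
proof -
  have c: "c \<noteq> 0" using assms by auto
  have eq: "(\<lambda>x. t + c *\<^sub>R x) = (\<lambda>x. t + (\<Sum>j\<in>Basis. (c * (x \<bullet> j)) *\<^sub>R j))"
    unfolding scaleR_scaleR[symmetric] scaleR_sum_right[symmetric] euclidean_representation by simp
  show "(\<lambda>x. t + c *\<^sub>R x) \<in> lebesgue \<rightarrow>\<^sub>M lebesgue"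
    unfolding eq by (rule lebesgue_affine_measurable) (use c in auto)
  have "lebesgue = density (distr lebesgue lebesgue (\<lambda>x. t + c *\<^sub>R x)) (\<lambda>_. (\<Prod>j\<in>(Basis::'a set). \<bar>c\<bar>))"
    unfolding eq by (rule lebesgue_affine_euclidean) (use c in auto)
  then show "distr lebesgue lebesgue (\<lambda>x. t + c *\<^sub>R x) = lebesgue"
    using assms by (simp add: density_1)
qed

lemma measurable_lebesgue_reflect [measurable]: "(\<lambda>y. x - y) \<in> lebesgue \<rightarrow>\<^sub>M lebesgue"
  and distr_lebesgue_reflect: "distr lebesgue lebesgue (\<lambda>y. x - y) = lebesgue"
  using distr_lebesgue_isometry[of "-1" x] by simp_all

lemma measurable_lebesgue_shift [measurable]: "(\<lambda>y. y - c) \<in> lebesgue \<rightarrow>\<^sub>M lebesgue"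
  and distr_lebesgue_shift: "distr lebesgue lebesgue (\<lambda>y. y - c) = lebesgue"
  using distr_lebesgue_isometry[of 1 "-c"] by simp_all

section \<open>Gaussian kernels\<close>

text \<open>The standard Gaussian density as a product over coordinates, so that its integrals
  factor into one-dimensional ones.\<close>

definition gauss :: "'a::euclidean_space \<Rightarrow> real" where
  "gauss y = (\<Prod>b\<in>Basis. std_normal_density (y \<bullet> b))"

lemma gauss_nonneg: "0 \<le> gauss y"
  unfolding gauss_def by (intro prod_nonneg) auto

lemma borel_measurable_gauss [measurable]: "gauss \<in> borel_measurable borel"
  unfolding gauss_def by measurable

lemma gauss_eq: "gauss (y::'a::euclidean_space) = exp (- (norm y)\<^sup>2 / 2) / sqrt (2 * pi) ^ DIM('a)"
proof -
  have "(norm y)\<^sup>2 = (\<Sum>b\<in>Basis. (y \<bullet> b)\<^sup>2)"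
    unfolding power2_norm_eq_inner by (subst euclidean_inner) (simp add: power2_eq_square)
  then have "exp (- (norm y)\<^sup>2 / 2) = (\<Prod>b\<in>Basis. exp (- (y \<bullet> b)\<^sup>2 / 2))"
    by (simp add: exp_sum[symmetric] sum_negf sum_divide_distrib)
  then show ?thesis
    unfolding gauss_def std_normal_density_def by (simp add: prod.distrib power_divide prod_dividef)
qed

lemma nn_integral_gauss: "(\<integral>\<^sup>+y. ennreal (gauss y) \<partial>lborel) = 1"
proof -
  have "(\<integral>\<^sup>+y. ennreal (gauss y) \<partial>(lborel::'a measure))
      = (\<integral>\<^sup>+y. (\<Prod>b\<in>(Basis::'a set). ennreal (std_normal_density (y \<bullet> b))) \<partial>lborel)"
    unfolding gauss_def by (simp add: prod_ennreal)
  also have "\<dots> = (\<Prod>b\<in>(Basis::'a set). (\<integral>\<^sup>+x. ennreal (std_normal_density x) \<partial>lborel))"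
    by (rule nn_integral_lborel_prod) auto
  also have "(\<integral>\<^sup>+x. ennreal (std_normal_density x) \<partial>lborel) = 1"
    by (simp add: nn_integral_eq_integral)
  finally show ?thesis by simp
qed

lemma integrable_gauss: "integrable lborel gauss"
  by (rule integrableI_nonneg) (auto simp: gauss_nonneg nn_integral_gauss)

lemma integral_gauss: "(LINT y|lborel. gauss y) = 1"
  by (simp add: integral_eq_nn_integral gauss_nonneg nn_integral_gauss)

text \<open>Density and character both factor over the basis. Viewing \<open>lborel\<close> as the
  image of a product measure, Fubini reduces the integral to the characteristic function of the
  one-dimensional standard normal distribution.\<close>

lemma integral_gauss_iexp:
  fixes t :: "'a::euclidean_space"
  shows "(LINT y|lborel. complex_of_real (gauss y) * iexp (y \<bullet> t)) = of_real (exp (- (norm t)\<^sup>2 / 2))"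
proof -
  interpret P: product_sigma_finite "\<lambda>b::'a. lborel :: real measure"
    by (simp add: product_sigma_finite_def sigma_finite_lborel)
  define q where "q = (\<lambda>b x. complex_of_real (std_normal_density x) * iexp (x * (t \<bullet> b)))"
  have intq: "integrable lborel (q b)" for b
  proof (rule Bochner_Integration.integrable_bound)
    show "integrable lborel std_normal_density" by simp
  qed (auto simp: q_def norm_mult)
  have q: "integral\<^sup>L lborel (q b) = of_real (exp (- (t \<bullet> b)\<^sup>2 / 2))" for b
  proof -
    have "integral\<^sup>L lborel (q b) = char std_normal_distribution (t \<bullet> b)"
      unfolding char_def q_def
      by (subst integral_density) (auto simp: scaleR_conv_of_real mult_ac)
    then show ?thesis by (simp add: char_std_normal_distribution)
  qed
  have prod: "complex_of_real (gauss y) * iexp (y \<bullet> t) = (\<Prod>b\<in>Basis. q b (y \<bullet> b))" for y :: 'a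
    unfolding gauss_def q_def prod.distrib of_real_prod
    by (simp add: exp_sum[symmetric] sum_distrib_left[symmetric] euclidean_inner[of y t] flip: of_real_sum of_real_mult)
  have "(LINT y|lborel. complex_of_real (gauss y) * iexp (y \<bullet> t)) = (LINT y|(lborel::'a measure). (\<Prod>b\<in>Basis. q b (y \<bullet> b)))"
    by (simp add: prod)
  also have "\<dots> = (LINT f|(\<Pi>\<^sub>M b\<in>(Basis::'a set). lborel). (\<Prod>b\<in>Basis. q b (f b)))"
    unfolding lborel_eq[where 'a='a] by (subst integral_distr) (auto simp: q_def)
  also have "\<dots> = (\<Prod>b\<in>Basis. integral\<^sup>L lborel (q b))"
    by (rule P.product_integral_prod) (auto simp: intq)
  also have "\<dots> = of_real (exp (- (norm t)\<^sup>2 / 2))"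
  proof -
    have "(norm t)\<^sup>2 = (\<Sum>b\<in>Basis. (t \<bullet> b)\<^sup>2)"
      unfolding power2_norm_eq_inner by (subst euclidean_inner) (simp add: power2_eq_square)
    then show ?thesis
      by (simp add: q exp_sum[symmetric] sum_negf sum_divide_distrib flip: of_real_prod)
  qed
  finally show ?thesis .
qed

lemma lborel_integral_scaleR:
  fixes F :: "'a::euclidean_space \<Rightarrow> 'b::{banach, second_countable_topology}"
  assumes [measurable]: "F \<in> borel_measurable borel" and c: "c \<noteq> 0"
  shows "(LINT x|lborel. F x) = \<bar>c\<bar> ^ DIM('a) *\<^sub>R (LINT x|lborel. F (t + c *\<^sub>R x))"
  by (subst lborel_affine[OF c, of t]) (simp add: integral_density integral_distr)

text \<open>The inverse Fourier transform of a wide Gaussian is a narrow one: the right-hand side is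
  an approximate identity as r grows. The substitution by c = r / (2\<pi>) normalizes the exponent
  and turns the phase into the inner product of y and r z.\<close>

lemma integral_scaled_gauss_iexp:
  fixes z :: "'a::euclidean_space"
  assumes r: "r > 0"
  shows "(LINT \<xi>|lborel. complex_of_real (exp (- (2 * pi * norm \<xi> / r)\<^sup>2 / 2)) * iexp (2 * pi * (\<xi> \<bullet> z)))
     = of_real (r ^ DIM('a) * gauss (r *\<^sub>R z))"
proof -
  let ?d = "DIM('a)"
  define c where "c = r / (2 * pi)"
  have c: "c > 0" using r by (simp add: c_def)
  let ?F = "\<lambda>\<xi>::'a. complex_of_real (exp (- (2 * pi * norm \<xi> / r)\<^sup>2 / 2)) * iexp (2 * pi * (\<xi> \<bullet> z))"
  have F: "?F (0 + c *\<^sub>R y) = of_real (sqrt (2 * pi) ^ ?d) * (complex_of_real (gauss y) * iexp (y \<bullet> (r *\<^sub>R z)))" for y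
    using r by (simp add: gauss_eq c_def mult_ac)
  have 1: "(LINT \<xi>|lborel. ?F \<xi>) = \<bar>c\<bar> ^ ?d *\<^sub>R (LINT y|lborel. ?F (0 + c *\<^sub>R y))"
    by (rule lborel_integral_scaleR) (use c in auto)
  have 2: "(LINT \<xi>|lborel. ?F \<xi>) = c ^ ?d *\<^sub>R (of_real (sqrt (2 * pi) ^ ?d) * of_real (exp (- (norm (r *\<^sub>R z))\<^sup>2 / 2)))"
    unfolding 1 by (simp only: F abs_of_pos[OF c] integral_mult_right_zero integral_gauss_iexp)
  \<comment> \<open>One factor is the normalizing constant pulled out of \<open>gauss y\<close>, the
    other is the one that \<open>gauss (r *\<^sub>R z)\<close> absorbs.\<close>
  have "(2 * pi) ^ ?d = sqrt (2 * pi) ^ ?d * sqrt (2 * pi) ^ ?d"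
    by (subst power_mult_distrib[symmetric]) simp
  moreover have "sqrt (2 * pi) ^ ?d \<noteq> 0" by simp
  ultimately have "c ^ ?d * (sqrt (2 * pi) ^ ?d * exp (- (norm (r *\<^sub>R z))\<^sup>2 / 2)) = (c * (2 * pi)) ^ ?d * gauss (r *\<^sub>R z)"
    by (simp only: gauss_eq power_mult_distrib[of c]) (simp add: mult_ac)
  moreover have "c * (2 * pi) = r" by (simp add: c_def)
  ultimately have "c ^ ?d * (sqrt (2 * pi) ^ ?d * exp (- (norm (r *\<^sub>R z))\<^sup>2 / 2)) = r ^ ?d * gauss (r *\<^sub>R z)"
    by simp
  from arg_cong[OF this, of complex_of_real] show ?thesis
    unfolding 2 by (simp only: scaleR_conv_of_real of_real_mult)
qed

section \<open>Plancherel's identity\<close>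

lemma fourier_borel:
  assumes [measurable]: "k \<in> borel_measurable borel"
  shows "fourier k \<xi> = (LINT x|lborel. k x * iexp (- (2 * pi * (x \<bullet> \<xi>))))"
proof -
  have "fourier k \<xi> = (LINT x|lborel. k x * exp (- (2 * of_real pi * \<i> * of_real (x \<bullet> \<xi>))))"
    unfolding fourier_def by (rule integral_completion) measurable
  then show ?thesis by (simp add: mult_ac)
qed

lemma borel_measurable_fourier:
  assumes [measurable]: "k \<in> borel_measurable borel"
  shows "fourier k \<in> borel_measurable borel"
proof -
  have "fourier k = (\<lambda>\<xi>. LINT x|lborel. k x * iexp (- (2 * pi * (x \<bullet> \<xi>))))"
    by (rule ext) (rule fourier_borel[OF assms])
  then show ?thesis by simp
qed

lemma norm_fourier_le:
  assumes [measurable]: "k \<in> borel_measurable borel"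
  shows "cmod (fourier k \<xi>) \<le> (LINT x|lborel. cmod (k x))"
  unfolding fourier_borel[OF assms]
  by (rule order_trans[OF integral_norm_bound]) (simp add: norm_mult)

text \<open>Supplies the absolute convergence behind the exchanges of integrals below; u stands for
  an oscillating exponential.\<close>

lemma integrable_pair_mult:
  fixes a :: "'a::euclidean_space \<Rightarrow> complex" and b :: "'b::euclidean_space \<Rightarrow> complex"
  assumes a: "integrable lborel a" and b: "integrable lborel b"
    and u: "u \<in> borel_measurable (lborel \<Otimes>\<^sub>M lborel)" "\<And>z. cmod (u z) \<le> 1"
  shows "integrable (lborel \<Otimes>\<^sub>M lborel) (\<lambda>(x, y). a x * b y * u (x, y))"
proof -
  have [measurable]: "a \<in> borel_measurable borel" "b \<in> borel_measurable borel"
    using a b borel_measurable_integrable by auto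
  have 1: "integrable (lborel \<Otimes>\<^sub>M lborel) (\<lambda>(x, y). a x * b y)"
    by (rule lborel_pair.Fubini_integrable) (use a b in \<open>auto simp: norm_mult\<close>)
  show ?thesis
  proof (rule Bochner_Integration.integrable_bound[OF 1])
    show "(\<lambda>(x, y). a x * b y * u (x, y)) \<in> borel_measurable (lborel \<Otimes>\<^sub>M lborel)"
      using u(1) by measurable
    show "AE z in lborel \<Otimes>\<^sub>M lborel. norm (case z of (x, y) \<Rightarrow> a x * b y * u (x, y)) \<le> norm (case z of (x, y) \<Rightarrow> a x * b y)"
      using u(2) by (auto simp: norm_mult intro!: AE_I2 mult_left_le)
  qed
qed

section \<open>Gaussian summation of the Fourier integral\<close>

text \<open>A summation factor: integrable for each r > 0, and increasing to 1 pointwise as r tends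
  to infinity.\<close>

definition gauss_weight :: "real \<Rightarrow> 'a::euclidean_space \<Rightarrow> real" where
  "gauss_weight r \<xi> = exp (- (2 * pi * norm \<xi> / r)\<^sup>2 / 2)"

lemma gauss_weight_gauss: "r > 0 \<Longrightarrow> gauss_weight r \<xi> = sqrt (2 * pi) ^ DIM('a) * gauss ((2 * pi / r) *\<^sub>R (\<xi>::'a::euclidean_space))"
  by (simp add: gauss_weight_def gauss_eq)

lemma borel_measurable_gauss_weight [measurable]: "gauss_weight r \<in> borel_measurable borel"
  unfolding gauss_weight_def by measurable

lemma integrable_lborel_scaleR:
  fixes F :: "'a::euclidean_space \<Rightarrow> 'b::{banach, second_countable_topology}"
  assumes F: "integrable lborel F" and c: "c \<noteq> 0"
  shows "integrable lborel (\<lambda>x. F (t + c *\<^sub>R x))"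
proof -
  have [measurable]: "F \<in> borel_measurable borel" using F borel_measurable_integrable by auto
  have "integrable (density (distr lborel borel (\<lambda>x. t + c *\<^sub>R x)) (\<lambda>_. ennreal (\<bar>c\<bar> ^ DIM('a)))) F"
    using F lborel_affine[OF c, of t] by (simp add: ennreal_power)
  then have "integrable lborel (\<lambda>x. \<bar>c\<bar> ^ DIM('a) *\<^sub>R F (t + c *\<^sub>R x))"
    by (simp add: integrable_density integrable_distr_eq)
  from integrable_scaleR_right[OF this, of "inverse (\<bar>c\<bar> ^ DIM('a))"] show ?thesis
    using c by simp
qed

lemma integrable_gauss_weight:
  assumes "r > 0"
  shows "integrable lborel (gauss_weight r :: 'a::euclidean_space \<Rightarrow> real)"
proof -
  have "gauss_weight r = (\<lambda>\<xi>::'a. sqrt (2 * pi) ^ DIM('a) * gauss (0 + (2 * pi / r) *\<^sub>R \<xi>))"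
    using assms by (simp add: gauss_weight_gauss fun_eq_iff)
  moreover have "integrable lborel (\<lambda>\<xi>::'a. gauss (0 + (2 * pi / r) *\<^sub>R \<xi>))"
    using assms by (intro integrable_lborel_scaleR integrable_gauss) auto
  ultimately show ?thesis by simp
qed

text \<open>Write the square as the transform times its conjugate, expand the conjugate, and move
  the \<xi>-integral inside. There the transform of k is expanded too, and the transform of the
  weight produces a Gaussian average of k around y at scale 1/r. The weight is what makes the double
  integrals absolutely convergent.\<close>

lemma gauss_weight_fourier_square:
  fixes k :: "'a::euclidean_space \<Rightarrow> complex"
  assumes k: "integrable lborel k" and r: "r > 0"
  shows "(LINT \<xi>|lborel. of_real (gauss_weight r \<xi> * (cmod (fourier k \<xi>))\<^sup>2))
     = (LINT y|lborel. cnj (k y) * (LINT z|lborel. of_real (gauss z) * k (y - z /\<^sub>R r)))"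
proof -
  have [measurable]: "k \<in> borel_measurable borel"
    using k borel_measurable_integrable by auto
  note [measurable] = borel_measurable_fourier[of k]
  have gk: "integrable lborel (\<lambda>\<xi>. of_real (gauss_weight r \<xi>) * fourier k \<xi>)"
  proof (rule Bochner_Integration.integrable_bound)
    show "integrable lborel (\<lambda>\<xi>::'a. gauss_weight r \<xi> * (LINT x|lborel. cmod (k x)))"
      by (simp add: integrable_gauss_weight r)
    show "AE x in lborel. norm (complex_of_real (gauss_weight r x) * fourier k x)
         \<le> norm (gauss_weight r x * (LINT x|lborel. cmod (k x)))"
      using norm_fourier_le[of k] by (auto simp: norm_mult abs_mult intro!: AE_I2 mult_left_mono intro: order_trans[OF _ abs_ge_self])
  qed measurable
  \<comment> \<open>Gaussian-regularized Fourier inversion for k.\<close>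
  have inner: "(LINT \<xi>|lborel. of_real (gauss_weight r \<xi>) * fourier k \<xi> * iexp (2 * pi * (y \<bullet> \<xi>)))
      = (LINT z|lborel. of_real (gauss z) * k (y - z /\<^sub>R r))" for y
  proof -
    have "(LINT \<xi>|lborel. of_real (gauss_weight r \<xi>) * fourier k \<xi> * iexp (2 * pi * (y \<bullet> \<xi>)))
       = (LINT \<xi>|lborel. (LINT x|lborel. of_real (gauss_weight r \<xi>) * k x * iexp (2 * pi * (\<xi> \<bullet> (y - x)))))"
    proof (rule Bochner_Integration.integral_cong[OF refl])
      fix \<xi> :: 'a
      have e: "iexp (2 * pi * (\<xi> \<bullet> (y - x))) = iexp (- (2 * pi * (x \<bullet> \<xi>))) * iexp (2 * pi * (y \<bullet> \<xi>))" for x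
        by (simp add: exp_add[symmetric] inner_diff_right algebra_simps inner_commute)
      show "of_real (gauss_weight r \<xi>) * fourier k \<xi> * iexp (2 * pi * (y \<bullet> \<xi>)) =
        (LINT x|lborel. of_real (gauss_weight r \<xi>) * k x * iexp (2 * pi * (\<xi> \<bullet> (y - x))))"
        unfolding e fourier_borel[OF \<open>k \<in> borel_measurable borel\<close>]
          integral_mult_right_zero[symmetric] integral_mult_left_zero[symmetric]
        by (simp only: mult_ac)
    qed
    also have "\<dots> = (LINT x|lborel. (LINT \<xi>|lborel. of_real (gauss_weight r \<xi>) * k x * iexp (2 * pi * (\<xi> \<bullet> (y - x)))))"
    proof (rule lborel_pair.Fubini_integral)
      have "integrable (lborel \<Otimes>\<^sub>M lborel) (\<lambda>(x, \<xi>). k x * of_real (gauss_weight r \<xi>) * (\<lambda>p. iexp (2 * pi * (snd p \<bullet> (y - fst p)))) (x, \<xi>))"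
        by (rule integrable_pair_mult[OF k]) (use integrable_gauss_weight[OF r] in auto)
      then show "integrable (lborel \<Otimes>\<^sub>M lborel) (\<lambda>(x, \<xi>). of_real (gauss_weight r \<xi>) * k x * iexp (2 * pi * (\<xi> \<bullet> (y - x))))"
        by (simp add: mult_ac)
    qed
    also have "\<dots> = (LINT x|lborel. k x * of_real (r ^ DIM('a) * gauss (r *\<^sub>R (y - x))))"
      unfolding integral_scaled_gauss_iexp[OF r, symmetric] gauss_weight_def
      by (simp only: integral_mult_right_zero[symmetric] mult_ac)
    \<comment> \<open>Substituting x = y - z / r makes the kernel \<open>gauss z\<close>; the
      Jacobian cancels the factor \<open>r ^ DIM('a)\<close>.\<close>
    also have "\<dots> = \<bar>- 1 / r\<bar> ^ DIM('a) *\<^sub>R (LINT z|lborel. k (y + (- 1 / r) *\<^sub>R z) * of_real (r ^ DIM('a) * gauss (r *\<^sub>R (y - (y + (- 1 / r) *\<^sub>R z)))))"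
      by (rule lborel_integral_scaleR) (use r in auto)
    also have "\<dots> = \<bar>- 1 / r\<bar> ^ DIM('a) *\<^sub>R (LINT z|lborel. of_real (r ^ DIM('a)) * (of_real (gauss z) * k (y - z /\<^sub>R r)))"
      using r by (simp add: mult_ac divide_inverse)
    also have "\<dots> = (LINT z|lborel. of_real (gauss z) * k (y - z /\<^sub>R r))"
      using r by (simp only: integral_mult_right_zero) (simp add: scaleR_conv_of_real power_divide)
    finally show ?thesis .
  qed
  have cnj_f: "cnj (fourier k \<xi>) = (LINT y|lborel. cnj (k y) * iexp (2 * pi * (y \<bullet> \<xi>)))" for \<xi>
    unfolding fourier_borel[OF \<open>k \<in> borel_measurable borel\<close>] Bochner_Integration.integral_cnj[symmetric]
    by (simp add: exp_cnj)
  have "(LINT \<xi>|lborel. of_real (gauss_weight r \<xi> * (cmod (fourier k \<xi>))\<^sup>2))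
      = (LINT \<xi>|lborel. (LINT y|lborel. of_real (gauss_weight r \<xi>) * fourier k \<xi> * cnj (k y) * iexp (2 * pi * (y \<bullet> \<xi>))))"
  proof (rule Bochner_Integration.integral_cong[OF refl])
    fix \<xi> :: 'a
    have "of_real (gauss_weight r \<xi> * (cmod (fourier k \<xi>))\<^sup>2) = of_real (gauss_weight r \<xi>) * fourier k \<xi> * cnj (fourier k \<xi>)"
      by (simp add: complex_norm_square[symmetric] mult.assoc)
    also have "\<dots> = (LINT y|lborel. of_real (gauss_weight r \<xi>) * fourier k \<xi> * cnj (k y) * iexp (2 * pi * (y \<bullet> \<xi>)))"
      unfolding cnj_f integral_mult_right_zero[symmetric] by (simp only: mult.assoc)
    finally show "of_real (gauss_weight r \<xi> * (cmod (fourier k \<xi>))\<^sup>2) =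
      (LINT y|lborel. of_real (gauss_weight r \<xi>) * fourier k \<xi> * cnj (k y) * iexp (2 * pi * (y \<bullet> \<xi>)))" .
  qed
  also have "\<dots> = (LINT y|lborel. (LINT \<xi>|lborel. of_real (gauss_weight r \<xi>) * fourier k \<xi> * cnj (k y) * iexp (2 * pi * (y \<bullet> \<xi>))))"
  proof (rule lborel_pair.Fubini_integral)
    have "integrable (lborel \<Otimes>\<^sub>M lborel) (\<lambda>(y, \<xi>). cnj (k y) * (of_real (gauss_weight r \<xi>) * fourier k \<xi>) * (\<lambda>p. iexp (2 * pi * (fst p \<bullet> snd p))) (y, \<xi>))"
      by (rule integrable_pair_mult[OF _ gk]) (use k in auto)
    then show "integrable (lborel \<Otimes>\<^sub>M lborel) (\<lambda>(y, \<xi>). of_real (gauss_weight r \<xi>) * fourier k \<xi> * cnj (k y) * iexp (2 * pi * (y \<bullet> \<xi>)))"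
      by (simp add: mult_ac)
  qed
  also have "\<dots> = (LINT y|lborel. cnj (k y) * (LINT z|lborel. of_real (gauss z) * k (y - z /\<^sub>R r)))"
    unfolding inner[symmetric] by (simp only: integral_mult_right_zero[symmetric] mult_ac)
  finally show ?thesis .
qed

text \<open>Let r tend to infinity in \<open>gauss_weight_fourier_square\<close>. The left side
  converges by monotone convergence, so square integrability of the transform need not be known
  beforehand. On the right, continuity makes the Gaussian averages converge to k pointwise, and the
  bound M on them gives the integrable majorant M |k|.\<close>

lemma plancherel:
  fixes k :: "'a::euclidean_space \<Rightarrow> complex"
  assumes k: "integrable lborel k" and cont: "continuous_on UNIV k" and bdd: "\<And>x. cmod (k x) \<le> M"
  shows "(\<integral>\<^sup>+\<xi>. ennreal ((cmod (fourier k \<xi>))\<^sup>2) \<partial>lborel) = (\<integral>\<^sup>+x. ennreal ((cmod (k x))\<^sup>2) \<partial>lborel)"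
proof -
  have [measurable]: "k \<in> borel_measurable borel"
    using k borel_measurable_integrable by auto
  note [measurable] = borel_measurable_fourier[of k]
  have M: "0 \<le> M" using bdd[of 0] norm_ge_zero order_trans by blast
  \<comment> \<open>The successor keeps the scale positive at n = 0.\<close>
  let ?r = "\<lambda>n. real (Suc n)"
  define w where "w = (\<lambda>n \<xi>. gauss_weight (?r n) \<xi> * (cmod (fourier k \<xi>))\<^sup>2)"
  have tr: "(\<lambda>n. x / ?r n) \<longlonglongrightarrow> 0" for x :: real
    using LIMSEQ_Suc[OF lim_const_over_n[of x]] by simp
  have w_lim: "(\<lambda>n. w n \<xi>) \<longlonglongrightarrow> (cmod (fourier k \<xi>))\<^sup>2" for \<xi>
  proof -
    have "(\<lambda>n. gauss_weight (?r n) \<xi>) \<longlonglongrightarrow> exp (- 0\<^sup>2 / 2)"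
      unfolding gauss_weight_def by (intro tendsto_intros tr) auto
    from tendsto_mult_right[OF this, of "(cmod (fourier k \<xi>))\<^sup>2"] show ?thesis
      by (simp add: w_def)
  qed
  have gauss_weight_pos: "0 \<le> gauss_weight r \<xi>" for r and \<xi> :: 'a by (simp add: gauss_weight_def)
  have w_inc: "incseq (\<lambda>n \<xi>. ennreal (w n \<xi>))"
  proof (rule incseq_SucI, rule le_funI, rule ennreal_leI)
    fix n :: nat and \<xi> :: 'a
    have "2 * pi * norm \<xi> / ?r (Suc n) \<le> 2 * pi * norm \<xi> / ?r n"
      by (intro divide_left_mono) auto
    then have "(2 * pi * norm \<xi> / ?r (Suc n))\<^sup>2 \<le> (2 * pi * norm \<xi> / ?r n)\<^sup>2"
      by (intro power_mono) auto
    then show "w n \<xi> \<le> w (Suc n) \<xi>"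
      unfolding w_def gauss_weight_def by (intro mult_right_mono) auto
  qed
  have [measurable]: "w n \<in> borel_measurable borel" for n
    unfolding w_def by measurable
  have lim1: "(\<lambda>n. \<integral>\<^sup>+\<xi>. ennreal (w n \<xi>) \<partial>lborel) \<longlonglongrightarrow> (\<integral>\<^sup>+\<xi>. ennreal ((cmod (fourier k \<xi>))\<^sup>2) \<partial>lborel)"
    by (rule nn_integral_LIMSEQ[OF w_inc]) (auto intro!: tendsto_ennrealI w_lim)
  have int_w: "integrable lborel (w n)" for n
  proof (rule Bochner_Integration.integrable_bound)
    show "integrable lborel (\<lambda>\<xi>::'a. gauss_weight (?r n) \<xi> * (LINT x|lborel. cmod (k x))\<^sup>2)"
      by (simp add: integrable_gauss_weight)
    show "AE x in lborel. norm (w n x) \<le> norm (gauss_weight (?r n) x * (LINT x|lborel. cmod (k x))\<^sup>2)"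
      using norm_fourier_le[of k] gauss_weight_pos by (auto simp: w_def intro!: AE_I2 mult_left_mono power_mono)
  qed measurable
  have nn_w: "(\<integral>\<^sup>+\<xi>. ennreal (w n \<xi>) \<partial>lborel) = ennreal (LINT \<xi>|lborel. w n \<xi>)" for n
    by (rule nn_integral_eq_integral[OF int_w]) (auto simp: w_def gauss_weight_pos)
  \<comment> \<open>The Gaussian average of k around y at scale 1/(n+1). Since \<open>gauss\<close>
    has total mass 1, it inherits the bound M.\<close>
  define A where "A = (\<lambda>n y. LINT z|lborel. complex_of_real (gauss z) * k (y - z /\<^sub>R ?r n))"
  have bA: "cmod (A n y) \<le> M" for n y
  proof -
    have "cmod (A n y) \<le> (LINT z|lborel. cmod (complex_of_real (gauss z) * k (y - z /\<^sub>R ?r n)))"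
      unfolding A_def by (rule integral_norm_bound)
    also have "\<dots> \<le> (LINT z|lborel. gauss (z::'a) * M)"
    proof (rule integral_mono')
      show "integrable lborel (\<lambda>z::'a. gauss z * M)" by (simp add: integrable_gauss)
    qed (auto simp: norm_mult gauss_nonneg M intro!: mult_mono bdd)
    also have "\<dots> = M" by (simp add: integral_gauss)
    finally show ?thesis .
  qed
  have limA: "(\<lambda>n. A n y) \<longlonglongrightarrow> k y" for y
  proof -
    have "(\<lambda>n. A n y) \<longlonglongrightarrow> (LINT z|lborel. complex_of_real (gauss (z::'a)) * k y)"
      unfolding A_def
    proof (rule integral_dominated_convergence[where w="\<lambda>z. gauss z * M"])
      show "integrable lborel (\<lambda>z::'a. gauss z * M)" by (simp add: integrable_gauss)
      show "AE z in lborel. (\<lambda>n. complex_of_real (gauss z) * k (y - z /\<^sub>R ?r n)) \<longlonglongrightarrow> complex_of_real (gauss z) * k y"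
      proof (rule AE_I2)
        fix z :: 'a
        have "(\<lambda>n. y - z /\<^sub>R ?r n) \<longlonglongrightarrow> y - 0 *\<^sub>R z"
          using tr[of 1] by (intro tendsto_intros) (simp add: divide_inverse)
        then have "(\<lambda>n. k (y - z /\<^sub>R ?r n)) \<longlonglongrightarrow> k y"
          using continuous_on_tendsto_compose[OF cont] by simp
        then show "(\<lambda>n. complex_of_real (gauss z) * k (y - z /\<^sub>R ?r n)) \<longlonglongrightarrow> complex_of_real (gauss z) * k y"
          by (intro tendsto_intros)
      qed
      show "AE z in lborel. norm (complex_of_real (gauss z) * k (y - z /\<^sub>R ?r n)) \<le> gauss z * M" for n
        by (auto simp: norm_mult gauss_nonneg intro!: AE_I2 mult_mono bdd)
    qed measurable
    also have "(LINT z|lborel. complex_of_real (gauss (z::'a)) * k y) = k y"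
      by (simp add: integrable_gauss integral_gauss)
    finally show ?thesis .
  qed
  have [measurable]: "A n \<in> borel_measurable borel" for n
    unfolding A_def by measurable
  have [measurable]: "(\<lambda>y. cnj (k y)) \<in> borel_measurable borel"
    by (rule measurable_compose[where f=k and g=cnj]) (auto intro: borel_measurable_continuous_onI continuous_on_cnj continuous_on_id)
  have "(\<lambda>n. LINT y|lborel. cnj (k y) * A n y) \<longlonglongrightarrow> (LINT y|lborel. cnj (k y) * k y)"
  proof (rule integral_dominated_convergence[where w="\<lambda>y. cmod (k y) * M"])
    show "integrable lborel (\<lambda>y. cmod (k y) * M)" using k by simp
  qed (auto simp: norm_mult intro!: AE_I2 mult_left_mono bA tendsto_intros limA)
  moreover have "(LINT y|lborel. cnj (k y) * A n y) = of_real (LINT \<xi>|lborel. w n \<xi>)" for n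
    unfolding A_def w_def integral_complex_of_real[symmetric]
    by (rule gauss_weight_fourier_square[OF k, symmetric]) simp
  moreover have "(LINT y|lborel. cnj (k y) * k y) = of_real (LINT y|lborel. (cmod (k y))\<^sup>2)"
    unfolding integral_complex_of_real[symmetric]
    by (rule Bochner_Integration.integral_cong[OF refl]) (simp add: complex_norm_square mult.commute del: of_real_power)
  ultimately have "(\<lambda>n. complex_of_real (LINT \<xi>|lborel. w n \<xi>)) \<longlonglongrightarrow> complex_of_real (LINT y|lborel. (cmod (k y))\<^sup>2)"
    by simp
  then have "(\<lambda>n. LINT \<xi>|lborel. w n \<xi>) \<longlonglongrightarrow> (LINT y|lborel. (cmod (k y))\<^sup>2)"
    by (simp only: tendsto_of_real_iff)
  then have "(\<lambda>n. \<integral>\<^sup>+\<xi>. ennreal (w n \<xi>) \<partial>lborel) \<longlonglongrightarrow> ennreal (LINT y|lborel. (cmod (k y))\<^sup>2)"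
    unfolding nn_w by (rule tendsto_ennrealI)
  with lim1 have "(\<integral>\<^sup>+\<xi>. ennreal ((cmod (fourier k \<xi>))\<^sup>2) \<partial>lborel) = ennreal (LINT y|lborel. (cmod (k y))\<^sup>2)"
    by (rule LIMSEQ_unique)
  \<comment> \<open>A bounded integrable function is square integrable; this lets the limit, a
    Bochner integral, be read as the extended-valued one.\<close>
  moreover have "integrable lborel (\<lambda>y. (cmod (k y))\<^sup>2)"
  proof (rule Bochner_Integration.integrable_bound)
    show "integrable lborel (\<lambda>y. cmod (k y) * M)" using k by simp
  qed (auto simp: power2_eq_square M intro!: AE_I2 mult_left_mono bdd)
  ultimately show ?thesis
    by (simp add: nn_integral_eq_integral)
qed

section \<open>Convolution of a bounded continuous integrable function with an integrable
  one\<close>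

lemma lborel_integral_shift:
  fixes F :: "'a::euclidean_space \<Rightarrow> 'b::{banach, second_countable_topology}"
  assumes "F \<in> borel_measurable borel"
  shows "(LINT x|lborel. F (x - y)) = (LINT x|lborel. F x)"
  using lborel_integral_scaleR[OF assms, of 1 "-y"] by simp

lemma integrable_lborel_shift:
  fixes F :: "'a::euclidean_space \<Rightarrow> 'b::{banach, second_countable_topology}"
  assumes "integrable lborel F"
  shows "integrable lborel (\<lambda>x. F (x - y))"
  using integrable_lborel_scaleR[OF assms, of 1 "-y"] by simp

context
  fixes h g :: "'a::euclidean_space \<Rightarrow> complex" and M :: real
  assumes h: "integrable lborel h" and cont: "continuous_on UNIV h" and bdd: "\<And>x. cmod (h x) \<le> M"
    and g: "integrable lborel g"
begin

lemma borel_factors: "h \<in> borel_measurable borel" "g \<in> borel_measurable borel"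
  using h g borel_measurable_integrable by auto

lemma convol_lborel: "convol h g x = (LINT y|lborel. h y * g (x - y))"
proof -
  note borel_factors [measurable]
  show ?thesis unfolding convol_def by (rule integral_completion) measurable
qed

text \<open>In this form x occurs only in the bounded continuous factor, so bounds and dominated
  convergence need nothing of g but integrability.\<close>

lemma convol_lborel': "convol h g x = (LINT y|lborel. h (x - y) * g y)"
proof -
  note borel_factors [measurable]
  show ?thesis
    using lborel_integral_scaleR[of "\<lambda>y. h y * g (x - y)" "-1" x] by (simp add: convol_lborel)
qed

lemma bound_nonneg: "0 \<le> M"
  using bdd[of 0] norm_ge_zero order_trans by blast

lemma convol_bounded: "cmod (convol h g x) \<le> M * (LINT y|lborel. cmod (g y))"
proof -
  have "cmod (convol h g x) \<le> (LINT y|lborel. cmod (h (x - y) * g y))"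
    unfolding convol_lborel' by (rule integral_norm_bound)
  also have "\<dots> \<le> (LINT y|lborel. M * cmod (g y))"
    using g by (intro integral_mono') (auto simp: norm_mult bound_nonneg intro!: mult_right_mono bdd)
  finally show ?thesis by simp
qed

lemma convol_continuous: "continuous_on UNIV (convol h g)"
  unfolding continuous_on_sequentially
proof (intro ballI allI impI, elim conjE)
  note borel_factors [measurable]
  fix u :: "nat \<Rightarrow> 'a" and a assume u: "u \<longlonglongrightarrow> a"
  have "(\<lambda>n. LINT y|lborel. h (u n - y) * g y) \<longlonglongrightarrow> (LINT y|lborel. h (a - y) * g y)"
  proof (rule integral_dominated_convergence[where w="\<lambda>y. M * cmod (g y)"])
    show "integrable lborel (\<lambda>y. M * cmod (g y))" using g by simp
    show "AE y in lborel. (\<lambda>n. h (u n - y) * g y) \<longlonglongrightarrow> h (a - y) * g y"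
    proof (rule AE_I2)
      fix y
      have "(\<lambda>n. u n - y) \<longlonglongrightarrow> a - y" using u by (intro tendsto_intros)
      then have "(\<lambda>n. h (u n - y)) \<longlonglongrightarrow> h (a - y)"
        using continuous_on_tendsto_compose[OF cont] by simp
      then show "(\<lambda>n. h (u n - y) * g y) \<longlonglongrightarrow> h (a - y) * g y" by (intro tendsto_intros)
    qed
  qed (auto simp: norm_mult bound_nonneg intro!: AE_I2 mult_right_mono bdd)
  then show "(convol h g \<circ> u) \<longlonglongrightarrow> convol h g a"
    by (simp add: convol_lborel' o_def)
qed

text \<open>Integrating over x first gives |h y| times the \<open>L\<^sup>1\<close> norm of g, by
  translation invariance. This yields both integrability of the convolution and the exchange of
  integrals in \<open>fourier_convol\<close>.\<close>

lemma convol_integrable_pair: "integrable (lborel \<Otimes>\<^sub>M lborel) (\<lambda>(y, x). h y * g (x - y))"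
proof (rule lborel_pair.Fubini_integrable)
  note borel_factors [measurable]
  show "(\<lambda>(y, x). h y * g (x - y)) \<in> borel_measurable (lborel \<Otimes>\<^sub>M lborel)"
    by measurable
  have "(LINT x|lborel. norm (h y * g (x - y))) = cmod (h y) * (LINT x|lborel. cmod (g x))" for y
    using lborel_integral_shift[of "\<lambda>x. cmod (g x)" y] by (simp add: norm_mult)
  then show "integrable lborel (\<lambda>y. LINT x|lborel. norm (case (y, x) of (y, x) \<Rightarrow> h y * g (x - y)))"
    using h by simp
  show "AE y in lborel. integrable lborel (\<lambda>x. case (y, x) of (y, x) \<Rightarrow> h y * g (x - y))"
    by (auto intro!: AE_I2 integrable_mult_right simp: integrable_lborel_shift[OF g])
qed

lemma convol_integrable: "integrable lborel (convol h g)"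
  using lborel_pair.integrable_snd[OF convol_integrable_pair] by (simp add: convol_lborel[abs_def])

text \<open>After the exchange of integrals the character at x splits into those at x - y and at y,
  and the shift in the inner integral disappears.\<close>

lemma fourier_convol: "fourier (convol h g) \<xi> = fourier h \<xi> * fourier g \<xi>"
proof -
  note borel_factors [measurable]
  have [measurable]: "convol h g \<in> borel_measurable borel"
    using convol_integrable borel_measurable_integrable by auto
  let ?e = "\<lambda>x. iexp (- (2 * pi * (x \<bullet> \<xi>)))"
  have "fourier (convol h g) \<xi> = (LINT x|lborel. (LINT y|lborel. h y * g (x - y) * ?e x))"
    by (simp add: fourier_borel convol_lborel)
  also have "\<dots> = (LINT y|lborel. (LINT x|lborel. h y * g (x - y) * ?e x))"
  proof (rule lborel_pair.Fubini_integral)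
    show "integrable (lborel \<Otimes>\<^sub>M lborel) (\<lambda>(y, x). h y * g (x - y) * ?e x)"
    proof (rule Bochner_Integration.integrable_bound[OF convol_integrable_pair])
    qed (auto simp: norm_mult)
  qed
  also have "\<dots> = (LINT y|lborel. h y * ?e y * fourier g \<xi>)"
  proof (rule Bochner_Integration.integral_cong[OF refl])
    fix y
    have e: "?e x = ?e (x - y) * ?e y" for x
      by (simp add: exp_add[symmetric] inner_diff_left algebra_simps)
    have "(LINT x|lborel. h y * g (x - y) * ?e x) = (LINT x|lborel. h y * ?e y * (g (x - y) * ?e (x - y)))"
      by (rule Bochner_Integration.integral_cong[OF refl]) (subst e, simp only: mult_ac)
    also have "\<dots> = h y * ?e y * (LINT x|lborel. g (x - y) * ?e (x - y))"
      by (rule integral_mult_right_zero)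
    also have "(LINT x|lborel. g (x - y) * ?e (x - y)) = fourier g \<xi>"
      using lborel_integral_shift[of "\<lambda>x. g x * ?e x" y] by (simp add: fourier_borel)
    finally show "(LINT x|lborel. h y * g (x - y) * ?e x) = h y * ?e y * fourier g \<xi>" .
  qed
  also have "\<dots> = fourier h \<xi> * fourier g \<xi>"
    by (simp add: fourier_borel)
  finally show ?thesis .
qed

text \<open>The convolution is again integrable, continuous and bounded, so
  \<open>plancherel\<close> applies to it.\<close>

lemma convol_energy_continuous:
  "(\<integral>\<^sup>+x. ennreal ((cmod (convol h g x))\<^sup>2) \<partial>lborel)
    = (\<integral>\<^sup>+\<xi>. ennreal ((cmod (fourier h \<xi>))\<^sup>2) * ennreal ((cmod (fourier g \<xi>))\<^sup>2) \<partial>lborel)"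
  unfolding plancherel[OF convol_integrable convol_continuous convol_bounded, symmetric]
  by (simp only: fourier_convol norm_mult power_mult_distrib ennreal_mult[OF zero_le_power2 zero_le_power2])

end

section \<open>Convolution with a Bessel family\<close>

text \<open>Connects filters that are only Lebesgue measurable with the Borel results above. Real
  and imaginary parts are replaced separately.\<close>

lemma lebesgue_ex_borel:
  fixes f :: "'a::euclidean_space \<Rightarrow> complex"
  assumes [measurable]: "f \<in> borel_measurable lebesgue"
  obtains f' where "f' \<in> borel_measurable borel" "AE x in lebesgue. f x = f' x"
proof -
  have "(\<lambda>x. Re (f x)) \<in> borel_measurable lebesgue" "(\<lambda>x. Im (f x)) \<in> borel_measurable lebesgue"
    by measurable
  from this[THEN completion_ex_borel_measurable_real] obtain a b
    where ab [measurable]: "a \<in> borel_measurable lborel" "b \<in> borel_measurable lborel"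
      and ae: "AE x in lborel. Re (f x) = a x" "AE x in lborel. Im (f x) = b x"
    by auto
  show thesis
  proof
    show "(\<lambda>x. Complex (a x) (b x)) \<in> borel_measurable borel"
      unfolding Complex_eq using ab by simp
    show "AE x in lebesgue. f x = Complex (a x) (b x)"
      using ae[THEN AE_completion] by eventually_elim (simp add: complex_eq_iff)
  qed
qed

lemma measurable_lebesgue_compose_reflect:
  "g \<in> lebesgue \<rightarrow>\<^sub>M M \<Longrightarrow> (\<lambda>y. g (x - y)) \<in> lebesgue \<rightarrow>\<^sub>M M"
  by (rule measurable_compose[OF measurable_lebesgue_reflect])

lemma measurable_lebesgue_compose_shift:
  "g \<in> lebesgue \<rightarrow>\<^sub>M M \<Longrightarrow> (\<lambda>y. g (y - c)) \<in> lebesgue \<rightarrow>\<^sub>M M"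
  by (rule measurable_compose[OF measurable_lebesgue_shift])

text \<open>Equality holds at every point because the reflection y \<mapsto> x - y preserves null
  sets.\<close>

lemma convol_cong_AE:
  fixes h g :: "'a::euclidean_space \<Rightarrow> complex"
  assumes h: "h \<in> borel_measurable lebesgue" and g: "g \<in> borel_measurable lebesgue"
    and g': "g' \<in> borel_measurable lebesgue" and ae: "AE x in lebesgue. g x = g' x"
  shows "convol h g = convol h g'"
proof
  fix x :: 'a
  have "AE y in distr lebesgue lebesgue (\<lambda>y. x - y). g y = g' y"
    using ae by (subst distr_lebesgue_reflect)
  then have ae': "AE y in lebesgue. g (x - y) = g' (x - y)"
    by (rule AE_distrD[OF measurable_lebesgue_reflect])
  note [measurable] = h measurable_lebesgue_compose_reflect[OF g, of x] measurable_lebesgue_compose_reflect[OF g', of x]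
  show "convol h g x = convol h g' x"
    unfolding convol_def by (rule integral_cong_AE) (use ae' in auto)
qed

lemma fourier_cong_AE:
  fixes g :: "'a::euclidean_space \<Rightarrow> complex"
  assumes [measurable]: "g \<in> borel_measurable lebesgue" "g' \<in> borel_measurable lebesgue"
    and ae: "AE x in lebesgue. g x = g' x"
  shows "fourier g = fourier g'"
proof
  fix \<xi> :: 'a
  have [measurable]: "(\<lambda>x. exp (- (2 * complex_of_real pi * \<i> * complex_of_real (x \<bullet> \<xi>)))) \<in> borel_measurable lebesgue"
    by (rule measurable_completion) measurable
  show "fourier g \<xi> = fourier g' \<xi>"
    unfolding fourier_def by (rule integral_cong_AE) (use ae in auto)
qed

section \<open>Energy inequality for finite Bessel families\<close>

text \<open>The squared \<open>L\<^sup>2\<close> norm, extended-valued so that energies can be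
  summed and compared before they are known to be finite.\<close>

definition sqnorm :: "('a::euclidean_space \<Rightarrow> complex) \<Rightarrow> ennreal" where
  "sqnorm h = (\<integral>\<^sup>+x. ennreal ((cmod (h x))\<^sup>2) \<partial>lebesgue)"

lemma L2_iff_sqnorm: "h \<in> L2 \<longleftrightarrow> h \<in> borel_measurable lebesgue \<and> sqnorm h < \<infinity>"
proof -
  have "(\<lambda>x. (cmod (h x))\<^sup>2) \<in> borel_measurable lebesgue" if "h \<in> borel_measurable lebesgue"
    using that by measurable
  then show ?thesis
    unfolding L2_def sqnorm_def integrable_iff_bounded mem_Collect_eq by (simp only: real_norm_def abs_power2) blast
qed

lemma L2_measurable: "h \<in> L2 \<Longrightarrow> h \<in> borel_measurable lebesgue"
  by (simp add: L2_def)

lemma L1_measurable: "h \<in> L1 \<Longrightarrow> h \<in> borel_measurable lebesgue"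
  by (simp add: L1_def borel_measurable_integrable)

lemma L2_convol_integrable:
  assumes h: "h \<in> L2" and g: "g \<in> L2"
  shows "integrable lebesgue (\<lambda>y. h y * g (x - y))"
proof (rule Bochner_Integration.integrable_bound)
  have g2: "integrable lebesgue (\<lambda>y. (cmod (g y))\<^sup>2)" and h2: "integrable lebesgue (\<lambda>y. (cmod (h y))\<^sup>2)"
    using g h by (auto simp: L2_def)
  have "integrable (distr lebesgue lebesgue (\<lambda>y. x - y)) (\<lambda>y. (cmod (g y))\<^sup>2)"
    using g2 by (simp add: distr_lebesgue_reflect)
  then have "integrable lebesgue (\<lambda>y. (cmod (g (x - y)))\<^sup>2)"
    by (rule integrable_distr[OF measurable_lebesgue_reflect])
  with h2 show "integrable lebesgue (\<lambda>y. (cmod (h y))\<^sup>2 + (cmod (g (x - y)))\<^sup>2)"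
    by (rule Bochner_Integration.integrable_add)
  show "(\<lambda>y. h y * g (x - y)) \<in> borel_measurable lebesgue"
    using L2_measurable[OF h] measurable_lebesgue_compose_reflect[OF L2_measurable[OF g]] by measurable
  show "AE y in lebesgue. norm (h y * g (x - y)) \<le> norm ((cmod (h y))\<^sup>2 + (cmod (g (x - y)))\<^sup>2)"
  proof (rule AE_I2)
    fix y
    have "2 * (cmod (h y) * cmod (g (x - y))) \<le> (cmod (h y))\<^sup>2 + (cmod (g (x - y)))\<^sup>2"
      using sum_squares_bound[of "cmod (h y)" "cmod (g (x - y))"] by simp
    moreover have "0 \<le> cmod (h y) * cmod (g (x - y))" by simp
    ultimately show "norm (h y * g (x - y)) \<le> norm ((cmod (h y))\<^sup>2 + (cmod (g (x - y)))\<^sup>2)"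
      unfolding norm_mult real_norm_def by linarith
  qed
qed

text \<open>The energy inequality for a single input h. Measurability is part of the property so
  that Fatou's lemma can carry it to limits. The sum is an ordinary one, with value 0 by convention
  for infinite index sets; it is applied to finite families.\<close>

definition bessel_at :: "'i set \<Rightarrow> ('i \<Rightarrow> 'a::euclidean_space \<Rightarrow> complex) \<Rightarrow> ('a \<Rightarrow> complex) \<Rightarrow> bool" where
  "bessel_at I g h \<longleftrightarrow> (\<forall>i\<in>I. convol h (g i) \<in> borel_measurable lebesgue) \<and>
     (\<Sum>i\<in>I. sqnorm (convol h (g i))) \<le> sqnorm h"

text \<open>By Plancherel the energies add up to the integral of the squared transform of h times
  the sum of the squared transforms of the filters, and that sum is at most 1.\<close>

lemma bessel_at_continuous:
  assumes g: "\<And>i. i \<in> I \<Longrightarrow> g i \<in> L1"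
    and bessel: "\<And>\<xi>. (\<Sum>i\<in>I. (cmod (fourier (g i) \<xi>))\<^sup>2) \<le> 1"
    and h: "integrable lborel h" and cont: "continuous_on UNIV h" and bdd: "\<And>x. cmod (h x) \<le> M"
  shows "bessel_at I g h"
proof -
  have [measurable]: "h \<in> borel_measurable borel"
    using h borel_measurable_integrable by auto
  have hl: "h \<in> borel_measurable lebesgue" by (rule measurable_completion) simp
  \<comment> \<open>Each filter is replaced by an integrable Borel version, which changes neither
    its convolution with h nor its Fourier transform.\<close>
  have "\<exists>g'. g' \<in> borel_measurable borel \<and> integrable lborel g' \<and> convol h (g i) = convol h g' \<and> fourier (g i) = fourier g'"
    if "i \<in> I" for i
  proof -
    have gi: "g i \<in> borel_measurable lebesgue" using L1_measurable g that by blast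
    then obtain g' where g' [measurable]: "g' \<in> borel_measurable borel" and ae: "AE x in lebesgue. g i x = g' x"
      by (rule lebesgue_ex_borel)
    have g'l: "g' \<in> borel_measurable lebesgue" by (rule measurable_completion) simp
    have "integrable lebesgue g'"
      using g[OF that] integrable_cong_AE[OF gi g'l ae] by (simp add: L1_def)
    then have "integrable lborel g'" using integrable_completion[of g' lborel] by simp
    with g' show ?thesis using convol_cong_AE[OF hl gi g'l ae] fourier_cong_AE[OF gi g'l ae] by blast
  qed
  then obtain k where k: "\<And>i. i \<in> I \<Longrightarrow> k i \<in> borel_measurable borel" "\<And>i. i \<in> I \<Longrightarrow> integrable lborel (k i)"
    "\<And>i. i \<in> I \<Longrightarrow> convol h (g i) = convol h (k i)" "\<And>i. i \<in> I \<Longrightarrow> fourier (g i) = fourier (k i)"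
    by metis
  have "(\<Sum>i\<in>I. sqnorm (convol h (g i)))
     = (\<Sum>i\<in>I. \<integral>\<^sup>+\<xi>. ennreal ((cmod (fourier h \<xi>))\<^sup>2) * ennreal ((cmod (fourier (g i) \<xi>))\<^sup>2) \<partial>lborel)"
    by (rule sum.cong[OF refl])
      (use k convol_energy_continuous[OF h cont bdd] in \<open>simp add: sqnorm_def nn_integral_completion\<close>)
  also have "\<dots> = (\<integral>\<^sup>+\<xi>. (\<Sum>i\<in>I. ennreal ((cmod (fourier h \<xi>))\<^sup>2) * ennreal ((cmod (fourier (g i) \<xi>))\<^sup>2)) \<partial>lborel)"
  proof (rule nn_integral_sum[symmetric])
    fix i assume "i \<in> I"
    then have [measurable]: "fourier (g i) \<in> borel_measurable borel" "fourier h \<in> borel_measurable borel"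
      using k(1,4) by (auto intro: borel_measurable_fourier)
    show "(\<lambda>\<xi>. ennreal ((cmod (fourier h \<xi>))\<^sup>2) * ennreal ((cmod (fourier (g i) \<xi>))\<^sup>2)) \<in> borel_measurable lborel"
      by measurable
  qed
  also have "\<dots> \<le> (\<integral>\<^sup>+\<xi>. ennreal ((cmod (fourier h \<xi>))\<^sup>2) \<partial>lborel)"
  proof (rule nn_integral_mono)
    fix \<xi>
    have "(\<Sum>i\<in>I. ennreal ((cmod (fourier h \<xi>))\<^sup>2) * ennreal ((cmod (fourier (g i) \<xi>))\<^sup>2))
      = ennreal ((cmod (fourier h \<xi>))\<^sup>2) * ennreal (\<Sum>i\<in>I. (cmod (fourier (g i) \<xi>))\<^sup>2)"
      by (simp add: sum_distrib_left[symmetric] sum_ennreal)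
    also have "\<dots> \<le> ennreal ((cmod (fourier h \<xi>))\<^sup>2) * 1"
      using bessel[of \<xi>] by (intro mult_left_mono) (auto simp: ennreal_le_1)
    finally show "(\<Sum>i\<in>I. ennreal ((cmod (fourier h \<xi>))\<^sup>2) * ennreal ((cmod (fourier (g i) \<xi>))\<^sup>2))
      \<le> ennreal ((cmod (fourier h \<xi>))\<^sup>2)" by simp
  qed
  also have "\<dots> = sqnorm h"
    unfolding plancherel[OF h cont bdd] by (simp add: sqnorm_def nn_integral_completion)
  finally have "(\<Sum>i\<in>I. sqnorm (convol h (g i))) \<le> sqnorm h" .
  moreover have "convol h (g i) \<in> borel_measurable lebesgue" if "i \<in> I" for i
  proof -
    have "integrable lborel (convol h (k i))"
      by (rule convol_integrable[OF h cont bdd k(2)[OF that]])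
    then have "convol h (k i) \<in> borel_measurable lborel" by (rule borel_measurable_integrable)
    then show ?thesis using k(3)[OF that] by (simp add: measurable_completion)
  qed
  ultimately show ?thesis by (simp add: bessel_at_def)
qed

lemma bessel_at_limit:
  assumes g: "\<And>i. i \<in> I \<Longrightarrow> g i \<in> L2"
    and H: "\<And>n. bessel_at I g (H n)" "\<And>n. H n \<in> borel_measurable lebesgue"
    and w: "w \<in> L2" and dom: "\<And>n x. cmod (H n x) \<le> cmod (w x)"
    and h [measurable]: "h \<in> borel_measurable lebesgue"
    and lim: "AE x in lebesgue. (\<lambda>n. H n x) \<longlonglongrightarrow> h x"
  shows "bessel_at I g h"
proof -
  note [measurable] = H(2) L2_measurable[OF w]
  have conv: "(\<lambda>n. convol (H n) (g i) x) \<longlonglongrightarrow> convol h (g i) x" if "i \<in> I" for i x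
    unfolding convol_def
  proof (rule integral_dominated_convergence[where w="\<lambda>y. cmod (w y * g i (x - y))"])
    note [measurable] = measurable_lebesgue_compose_reflect[OF L2_measurable[OF g[OF that]], of x]
    show "(\<lambda>y. h y * g i (x - y)) \<in> borel_measurable lebesgue"
      "(\<lambda>y. H n y * g i (x - y)) \<in> borel_measurable lebesgue" for n
      by measurable
    show "integrable lebesgue (\<lambda>y. cmod (w y * g i (x - y)))"
      using L2_convol_integrable[OF w g[OF that]] by (rule integrable_norm)
    show "AE y in lebesgue. (\<lambda>n. H n y * g i (x - y)) \<longlonglongrightarrow> h y * g i (x - y)"
      using lim by eventually_elim (intro tendsto_intros)
    show "AE y in lebesgue. norm (H n y * g i (x - y)) \<le> cmod (w y * g i (x - y))" for n
      using dom by (auto simp: norm_mult intro!: AE_I2 mult_right_mono)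
  qed
  have meas: "convol h (g i) \<in> borel_measurable lebesgue" if "i \<in> I" for i
    by (rule borel_measurable_LIMSEQ_metric[where f="\<lambda>n. convol (H n) (g i)"])
      (use H(1) conv that in \<open>auto simp: bessel_at_def\<close>)
  have measH: "convol (H n) (g i) \<in> borel_measurable lebesgue" if "i \<in> I" for i n
    using H(1) that by (auto simp: bessel_at_def)
  have sum_eq: "(\<Sum>i\<in>I. sqnorm (convol u (g i))) = (\<integral>\<^sup>+x. (\<Sum>i\<in>I. ennreal ((cmod (convol u (g i) x))\<^sup>2)) \<partial>lebesgue)"
    if "\<And>i. i \<in> I \<Longrightarrow> convol u (g i) \<in> borel_measurable lebesgue" for u
    unfolding sqnorm_def by (rule nn_integral_sum[symmetric]) (use that in measurable)
  have sq: "(\<lambda>n. sqnorm (H n)) \<longlonglongrightarrow> sqnorm h"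
    unfolding sqnorm_def
  proof (rule nn_integral_dominated_convergence[where w="\<lambda>x. ennreal ((cmod (w x))\<^sup>2)"])
    show "(\<integral>\<^sup>+x. ennreal ((cmod (w x))\<^sup>2) \<partial>lebesgue) < \<infinity>"
      using w by (simp add: L2_iff_sqnorm sqnorm_def)
    show "AE x in lebesgue. (\<lambda>n. ennreal ((cmod (H n x))\<^sup>2)) \<longlonglongrightarrow> ennreal ((cmod (h x))\<^sup>2)"
      using lim by eventually_elim (intro tendsto_ennrealI tendsto_intros)
    show "AE x in lebesgue. ennreal ((cmod (H n x))\<^sup>2) \<le> ennreal ((cmod (w x))\<^sup>2)" for n
      using dom by (auto intro!: AE_I2 ennreal_leI power_mono)
  qed measurable
  have "(\<Sum>i\<in>I. sqnorm (convol h (g i))) = (\<integral>\<^sup>+x. (\<Sum>i\<in>I. ennreal ((cmod (convol h (g i) x))\<^sup>2)) \<partial>lebesgue)"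
    by (rule sum_eq) (rule meas)
  also have "\<dots> = (\<integral>\<^sup>+x. liminf (\<lambda>n. \<Sum>i\<in>I. ennreal ((cmod (convol (H n) (g i) x))\<^sup>2)) \<partial>lebesgue)"
  proof (rule nn_integral_cong)
    fix x
    have "(\<lambda>n. \<Sum>i\<in>I. ennreal ((cmod (convol (H n) (g i) x))\<^sup>2)) \<longlonglongrightarrow> (\<Sum>i\<in>I. ennreal ((cmod (convol h (g i) x))\<^sup>2))"
      by (intro tendsto_sum tendsto_ennrealI tendsto_power tendsto_norm conv)
    from lim_imp_Liminf[OF sequentially_bot this]
    show "(\<Sum>i\<in>I. ennreal ((cmod (convol h (g i) x))\<^sup>2)) = liminf (\<lambda>n. \<Sum>i\<in>I. ennreal ((cmod (convol (H n) (g i) x))\<^sup>2))"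
      by simp
  qed
  also have "\<dots> \<le> liminf (\<lambda>n. \<integral>\<^sup>+x. (\<Sum>i\<in>I. ennreal ((cmod (convol (H n) (g i) x))\<^sup>2)) \<partial>lebesgue)"
    by (rule nn_integral_liminf) (use measH in measurable)
  also have "\<dots> \<le> liminf (\<lambda>n. sqnorm (H n))"
  proof (rule Liminf_mono, rule always_eventually, rule allI)
    fix n
    show "(\<integral>\<^sup>+x. (\<Sum>i\<in>I. ennreal ((cmod (convol (H n) (g i) x))\<^sup>2)) \<partial>lebesgue) \<le> sqnorm (H n)"
      using H(1)[of n] sum_eq[of "H n"] measH by (auto simp: bessel_at_def)
  qed
  also have "\<dots> = sqnorm h"
    by (rule lim_imp_Liminf[OF sequentially_bot sq])
  finally show ?thesis using meas by (simp add: bessel_at_def)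
qed

text \<open>Lebesgue measurability provides continuous functions converging to h off a negligible
  set. Suitably modified, they satisfy the hypotheses of \<open>bessel_at_continuous\<close>, and
  \<open>bessel_at_limit\<close> passes to h.\<close>

lemma bessel_at_bounded:
  fixes g :: "'i \<Rightarrow> 'a::euclidean_space \<Rightarrow> complex"
  assumes g: "\<And>i. i \<in> I \<Longrightarrow> g i \<in> L1 \<inter> L2"
    and bessel: "\<And>\<xi>. (\<Sum>i\<in>I. (cmod (fourier (g i) \<xi>))\<^sup>2) \<le> 1"
    and h [measurable]: "h \<in> borel_measurable lebesgue"
    and M: "M > 0" and bdd: "\<And>x. cmod (h x) \<le> M" and supp: "\<And>x. norm x > M \<Longrightarrow> h x = 0"
  shows "bessel_at I g h"
proof -
  have "h measurable_on UNIV"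
    by (rule lebesgue_measurable_imp_measurable_on) auto
  then obtain N F where N: "negligible N" and F: "\<And>n. continuous_on UNIV (F n)"
    and FN: "\<And>x. x \<notin> N \<Longrightarrow> (\<lambda>n::nat. F n x) \<longlonglongrightarrow> h x"
    by (auto simp: measurable_on_def)
  \<comment> \<open>Clipping and cutting off keep the continuous approximants of \<open>h\<close> dominated by \<open>w\<close>.\<close>
  define clip where "clip = (\<lambda>z::complex. z /\<^sub>R max 1 (cmod z / M))"
  define cut where "cut = (\<lambda>x::'a. max 0 (min 1 (M + 1 - norm x)))"
  define H where "H = (\<lambda>n x. cut x *\<^sub>R clip (F n x))"
  define w where "w = (\<lambda>x::'a. complex_of_real (M * indicator (cball 0 (M + 1)) x))"
  have clip_cont: "continuous_on UNIV clip"
    unfolding clip_def by (intro continuous_intros) (use M in \<open>auto simp: max_def\<close>)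
  have clip_le: "cmod (clip z) \<le> M" for z
    using M by (auto simp: clip_def max_def field_simps)
  have clip_id: "clip z = z" if "cmod z \<le> M" for z
    using that M by (auto simp: clip_def max_def field_simps)
  have H_cont: "continuous_on UNIV (H n)" for n
    unfolding H_def cut_def
    by (intro continuous_intros continuous_on_compose2[OF clip_cont F]) auto
  have H_dom: "cmod (H n x) \<le> cmod (w x)" for n x
  proof -
    have "cut x * cmod (clip (F n x)) \<le> indicator (cball 0 (M + 1)) x * M"
      by (rule mult_mono) (auto simp: cut_def clip_le indicator_def)
    then show ?thesis using M by (simp add: H_def w_def cut_def norm_mult mult.commute)
  qed
  have w_le: "cmod (w x) \<le> M" for x
    using M by (auto simp: w_def indicator_def)
  have [measurable]: "cball (0::'a) (M + 1) \<in> sets borel"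
    by (rule borel_closed) simp
  have [measurable]: "w \<in> borel_measurable borel"
    unfolding w_def by (intro measurable_compose[OF _ borel_measurable_of_real] borel_measurable_times borel_measurable_const borel_measurable_indicator) simp
  have w_int: "integrable lborel w"
  proof -
    have "integrable lborel (indicator (cball (0::'a) (M + 1)) :: 'a \<Rightarrow> real)"
      by (rule integrable_real_indicator) (use emeasure_bounded_finite[OF bounded_cball, of 0 "M + 1"] in auto)
    then show ?thesis unfolding w_def by simp
  qed
  have w_L2: "w \<in> L2"
  proof -
    have "integrable lborel (\<lambda>x. (cmod (w x))\<^sup>2)"
    proof (rule Bochner_Integration.integrable_bound)
      show "integrable lborel (\<lambda>x. cmod (w x) * M)" using w_int by simp
    qed (use M in \<open>auto simp: power2_eq_square intro!: AE_I2 mult_left_mono w_le\<close>)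
    moreover have "w \<in> borel_measurable lebesgue" by (rule measurable_completion) simp
    ultimately show ?thesis
      by (simp add: L2_def integrable_completion)
  qed
  have [measurable]: "H n \<in> borel_measurable borel" for n
    using H_cont by (rule borel_measurable_continuous_onI)
  have H_int: "integrable lborel (H n)" for n
    by (rule Bochner_Integration.integrable_bound[OF w_int]) (auto simp: H_dom)
  have H_bdd: "cmod (H n x) \<le> M" for n x
    using H_dom w_le order_trans by blast
  show ?thesis
  proof (rule bessel_at_limit[OF _ _ _ w_L2 H_dom h])
    show "g i \<in> L2" if "i \<in> I" for i using g that by blast
    show "bessel_at I g (H n)" for n
      using g by (intro bessel_at_continuous[OF _ bessel H_int H_cont H_bdd]) auto
    show "H n \<in> borel_measurable lebesgue" for n by (rule measurable_completion) simp
    have "N \<in> null_sets lebesgue" using N by (simp add: negligible_iff_null_sets)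
    then have "AE x in lebesgue. x \<notin> N" by (rule AE_not_in)
    then show "AE x in lebesgue. (\<lambda>n. H n x) \<longlonglongrightarrow> h x"
    proof eventually_elim
      fix x assume "x \<notin> N"
      then have "(\<lambda>n. clip (F n x)) \<longlonglongrightarrow> clip (h x)"
        using continuous_on_tendsto_compose[OF clip_cont FN] by simp
      then have "(\<lambda>n. H n x) \<longlonglongrightarrow> cut x *\<^sub>R clip (h x)"
        unfolding H_def by (intro tendsto_intros)
      \<comment> \<open>Where the norm of x is at most M, \<open>cut\<close> is 1 and
        \<open>clip\<close> fixes h x; elsewhere h x is 0.\<close>
      also have "cut x *\<^sub>R clip (h x) = h x"
        using supp[of x] by (cases "norm x > M") (auto simp: clip_id[OF bdd] clip_id[of 0] cut_def less_imp_le[OF M])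
      finally show "(\<lambda>n. H n x) \<longlonglongrightarrow> h x" .
    qed
  qed
qed

lemma bessel_at_L2:
  fixes g :: "'i \<Rightarrow> 'a::euclidean_space \<Rightarrow> complex"
  assumes g: "\<And>i. i \<in> I \<Longrightarrow> g i \<in> L1 \<inter> L2"
    and bessel: "\<And>\<xi>. (\<Sum>i\<in>I. (cmod (fourier (g i) \<xi>))\<^sup>2) \<le> 1"
    and h: "h \<in> L2"
  shows "bessel_at I g h"
proof -
  \<comment> \<open>Truncation in space and in size at one common threshold, matching the single
    bound M > 0 of \<open>bessel_at_bounded\<close>.\<close>
  define H where "H = (\<lambda>n x. if norm x \<le> real (Suc n) \<and> cmod (h x) \<le> real (Suc n) then h x else 0)"
  have hm [measurable]: "h \<in> borel_measurable lebesgue" by (rule L2_measurable[OF h])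
  have [measurable]: "(\<lambda>x::'a. norm x) \<in> borel_measurable lebesgue"
    by (rule measurable_completion) measurable
  have Hm: "H n \<in> borel_measurable lebesgue" for n
    unfolding H_def by measurable
  show ?thesis
  proof (rule bessel_at_limit[OF _ _ Hm h _ hm])
    show "g i \<in> L2" if "i \<in> I" for i using g that by blast
    show "bessel_at I g (H n)" for n
      by (rule bessel_at_bounded[OF g bessel Hm, of "real (Suc n)"]) (auto simp: H_def)
    show "cmod (H n x) \<le> cmod (h x)" for n x by (simp add: H_def)
    show "AE x in lebesgue. (\<lambda>n. H n x) \<longlonglongrightarrow> h x"
    proof (rule AE_I2)
      fix x
      obtain m where m: "max (norm x) (cmod (h x)) \<le> real m" using real_arch_simple by blast
      have "eventually (\<lambda>n. H n x = h x) sequentially"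
        using eventually_ge_at_top[of m] by eventually_elim (use m in \<open>auto simp: H_def\<close>)
      then show "(\<lambda>n. H n x) \<longlonglongrightarrow> h x" by (rule tendsto_eventually)
    qed
  qed
qed

lemma sqnorm_cmult: "sqnorm (\<lambda>x. c * h x) = ennreal ((cmod c)\<^sup>2) * sqnorm h"
  if "h \<in> borel_measurable lebesgue"
proof -
  have [measurable]: "(\<lambda>x. ennreal ((cmod (h x))\<^sup>2)) \<in> borel_measurable lebesgue"
    using that by measurable
  show ?thesis
    unfolding sqnorm_def norm_mult power_mult_distrib ennreal_mult[OF zero_le_power2 zero_le_power2]
    by (rule nn_integral_cmult) fact
qed

text \<open>The output filter d is adjoined to the family under the new index \<open>None\<close>,
  and its energy is then split off from the sum.\<close>

lemma bessel_at_pair: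
  fixes g :: "'i \<Rightarrow> 'a::euclidean_space \<Rightarrow> complex"
  assumes A: "finite A" and d: "d \<in> L1 \<inter> L2" and g: "\<And>l. l \<in> A \<Longrightarrow> g l \<in> L1 \<inter> L2"
    and bessel: "\<And>\<xi>. (cmod (fourier d \<xi>))\<^sup>2 + (\<Sum>l\<in>A. (cmod (fourier (g l) \<xi>))\<^sup>2) \<le> 1"
    and h: "h \<in> L2"
  shows "sqnorm (convol h d) + (\<Sum>l\<in>A. sqnorm (convol h (g l))) \<le> sqnorm h"
    and "convol h d \<in> borel_measurable lebesgue"
    and "l \<in> A \<Longrightarrow> convol h (g l) \<in> borel_measurable lebesgue"
proof -
  define I where "I = insert None (Some ` A)"
  define k where "k = case_option d g"
  have sum_I: "(\<Sum>i\<in>I. F i) = F None + (\<Sum>l\<in>A. F (Some l))" for F :: "'i option \<Rightarrow> 'b::comm_monoid_add"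
    unfolding I_def using A by (subst sum.insert) (auto simp: sum.reindex)
  have "bessel_at I k h"
  proof (rule bessel_at_L2[OF _ _ h])
    show "k i \<in> L1 \<inter> L2" if "i \<in> I" for i
      using that d g by (auto simp: I_def k_def)
    show "(\<Sum>i\<in>I. (cmod (fourier (k i) \<xi>))\<^sup>2) \<le> 1" for \<xi>
      unfolding sum_I using bessel[of \<xi>] by (simp add: k_def)
  qed
  then show "sqnorm (convol h d) + (\<Sum>l\<in>A. sqnorm (convol h (g l))) \<le> sqnorm h"
    "convol h d \<in> borel_measurable lebesgue"
    "l \<in> A \<Longrightarrow> convol h (g l) \<in> borel_measurable lebesgue"
    unfolding bessel_at_def sum_I by (auto simp: k_def I_def)
qed

section \<open>Scattering transforms\<close>

lemma sqnorm_modulus: "sqnorm (\<lambda>x. of_real (cmod (h x))) = sqnorm h"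
  by (simp add: sqnorm_def)

text \<open>Recursion at the first filter: the rest of the path is a path starting from the modulus.
  The inductions below, with arbitrary input, follow this form.\<close>

lemma propagator_Cons: "propagator g (l # p) h = propagator g p (\<lambda>x. of_real (cmod (convol h (g l) x)))"
  by (simp add: propagator_def)

lemma modulus_convol_L2:
  assumes "g \<in> L1 \<inter> L2" and bessel: "\<And>\<xi>. cmod (fourier g \<xi>) \<le> 1" and h: "h \<in> L2"
  shows "(\<lambda>x. of_real (cmod (convol h g x))) \<in> L2"
proof -
  have b: "(cmod (fourier g \<xi>))\<^sup>2 + (\<Sum>l\<in>{}. (cmod (fourier g \<xi>))\<^sup>2) \<le> 1" for \<xi>
    using bessel[of \<xi>] by (simp add: power_le_one)
  \<comment> \<open>With no further filters this is the energy inequality for g alone.\<close>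
  note p = bessel_at_pair[where A="{}" and d=g and g="\<lambda>_. g", OF _ assms(1) _ b h]
  have m: "convol h g \<in> borel_measurable lebesgue" using p(2) by simp
  have "sqnorm (convol h g) \<le> sqnorm h" using p(1) by simp
  then have "sqnorm (convol h g) < \<infinity>" using h by (auto simp: L2_iff_sqnorm)
  moreover have "(\<lambda>x. complex_of_real (cmod (convol h g x))) \<in> borel_measurable lebesgue"
    using m by measurable
  ultimately show ?thesis by (simp add: L2_iff_sqnorm sqnorm_modulus)
qed

lemma propagator_L2:
  assumes "\<And>l. l \<in> set p \<Longrightarrow> g l \<in> L1 \<inter> L2" and "\<And>l \<xi>. l \<in> set p \<Longrightarrow> cmod (fourier (g l) \<xi>) \<le> 1" and "h \<in> L2"
  shows "propagator g p h \<in> L2"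
  using assms
proof (induction p arbitrary: h)
  case (Cons l p)
  have "(\<lambda>x. complex_of_real (cmod (convol h (g l) x))) \<in> L2"
    by (rule modulus_convol_L2) (use Cons.prems in auto)
  then show ?case unfolding propagator_Cons using Cons.IH Cons.prems by simp
qed simp

text \<open>Induction on the depth of the tree of paths, for all inputs at once. At the root, the
  output energy and the energies sent to the children sum to at most \<open>sqnorm h\<close>. By the
  induction hypothesis the subtree of a child outputs no more than the energy entering it, as taking
  the modulus keeps the energy.\<close>

lemma scattering_energy_le:
  fixes g :: "'i \<Rightarrow> 'a::euclidean_space \<Rightarrow> complex"
  assumes A: "finite A" and d: "d \<in> L1 \<inter> L2" and g: "\<And>l. l \<in> A \<Longrightarrow> g l \<in> L1 \<inter> L2"
    and bessel: "\<And>\<xi>. (cmod (fourier d \<xi>))\<^sup>2 + (\<Sum>l\<in>A. (cmod (fourier (g l) \<xi>))\<^sup>2) \<le> 1"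
    and h: "h \<in> L2"
  shows "(\<Sum>p\<in>{p. set p \<subseteq> A \<and> length p \<le> N}. sqnorm (convol (propagator g p h) d)) \<le> sqnorm h"
  using h
proof (induction N arbitrary: h)
  case 0
  have "{p. set p \<subseteq> A \<and> length p \<le> 0} = {[]}" by auto
  moreover have "sqnorm (convol h d) \<le> sqnorm (convol h d) + (\<Sum>l\<in>A. sqnorm (convol h (g l)))" by simp
  then have "sqnorm (convol h d) \<le> sqnorm h"
    using bessel_at_pair(1)[OF A d g bessel 0] by (rule order_trans)
  ultimately show ?case by simp
next
  case (Suc N)
  let ?P = "\<lambda>N. {p. set p \<subseteq> A \<and> length p \<le> N}"
  let ?m = "\<lambda>l x. complex_of_real (cmod (convol h (g l) x))"
  have P: "?P (Suc N) = insert [] ((\<lambda>(l, p). l # p) ` (A \<times> ?P N))"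
  proof (rule set_eqI)
    fix p show "p \<in> ?P (Suc N) \<longleftrightarrow> p \<in> insert [] ((\<lambda>(l, p). l # p) ` (A \<times> ?P N))"
      by (cases p) auto
  qed
  have fin: "finite (?P N)" by (rule finite_lists_length_le[OF A])
  have mL2: "?m l \<in> L2" if "l \<in> A" for l
  proof (rule modulus_convol_L2[OF g[OF that] _ Suc.prems])
    fix \<xi>
    have "(cmod (fourier (g l) \<xi>))\<^sup>2 \<le> (\<Sum>l\<in>A. (cmod (fourier (g l) \<xi>))\<^sup>2)"
      by (rule member_le_sum) (use A that in auto)
    also have "\<dots> \<le> 1" using bessel[of \<xi>] zero_le_power2[of "cmod (fourier d \<xi>)"] by linarith
    finally show "cmod (fourier (g l) \<xi>) \<le> 1" by (simp add: power_le_one_iff abs_square_le_1)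
  qed
  have "(\<Sum>p\<in>?P (Suc N). sqnorm (convol (propagator g p h) d))
     = sqnorm (convol h d) + (\<Sum>z\<in>(\<lambda>(l, p). l # p) ` (A \<times> ?P N). sqnorm (convol (propagator g z h) d))"
    unfolding P by (subst sum.insert) (use A fin in auto)
  also have "(\<Sum>z\<in>(\<lambda>(l, p). l # p) ` (A \<times> ?P N). sqnorm (convol (propagator g z h) d))
     = (\<Sum>(l, p)\<in>A \<times> ?P N. sqnorm (convol (propagator g p (?m l)) d))"
    by (subst sum.reindex) (auto simp: inj_on_def propagator_Cons intro!: sum.cong)
  also have "\<dots> = (\<Sum>l\<in>A. \<Sum>p\<in>?P N. sqnorm (convol (propagator g p (?m l)) d))"
    by (rule sum.cartesian_product[symmetric])
  also have "sqnorm (convol h d) + \<dots> \<le> sqnorm (convol h d) + (\<Sum>l\<in>A. sqnorm (?m l))"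
    by (intro add_left_mono sum_mono Suc.IH mL2)
  also have "\<dots> \<le> sqnorm h"
    unfolding sqnorm_modulus by (rule bessel_at_pair(1)[OF A d g bessel Suc.prems])
  finally show ?case .
qed

section \<open>Translations and differences of filters\<close>

lemma integral_lebesgue_shift:
  fixes F :: "'a::euclidean_space \<Rightarrow> 'b::{banach, second_countable_topology}"
  assumes "F \<in> borel_measurable lebesgue"
  shows "(LINT y|lebesgue. F (y - c)) = (LINT y|lebesgue. F y)"
  using integral_distr[OF measurable_lebesgue_shift assms, of c]
  by (subst (asm) distr_lebesgue_shift) simp

lemma convol_translation:
  fixes h g :: "'a::euclidean_space \<Rightarrow> complex"
  assumes h: "h \<in> borel_measurable lebesgue" and g: "g \<in> borel_measurable lebesgue"
  shows "convol (translation c h) g = translation c (convol h g)"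
proof
  fix x :: 'a
  have m: "(\<lambda>y. h y * g (x - c - y)) \<in> borel_measurable lebesgue"
    using h measurable_lebesgue_compose_reflect[OF g, of "x - c"] by measurable
  show "convol (translation c h) g x = translation c (convol h g) x"
    using integral_lebesgue_shift[OF m, of c] by (simp add: convol_def translation_def algebra_simps)
qed

text \<open>Convolution commutes with translation and the modulus acts pointwise. The bounds on the
  filters keep the intermediate functions in \<open>L2\<close>, hence measurable, as
  \<open>convol_translation\<close> requires.\<close>

lemma propagator_translation:
  assumes "\<And>l. l \<in> set p \<Longrightarrow> g l \<in> L1 \<inter> L2" and "\<And>l \<xi>. l \<in> set p \<Longrightarrow> cmod (fourier (g l) \<xi>) \<le> 1" and "h \<in> L2"
  shows "propagator g p (translation c h) = translation c (propagator g p h)"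
  using assms
proof (induction p arbitrary: h)
  case (Cons l p)
  have "(\<lambda>x. complex_of_real (cmod (convol h (g l) x))) \<in> L2"
    by (rule modulus_convol_L2) (use Cons.prems in auto)
  moreover have "convol (translation c h) (g l) = translation c (convol h (g l))"
    using Cons.prems by (intro convol_translation L2_measurable) auto
  then have "(\<lambda>x. complex_of_real (cmod (convol (translation c h) (g l) x)))
     = translation c (\<lambda>x. complex_of_real (cmod (convol h (g l) x)))"
    by (simp add: translation_def)
  ultimately show ?case unfolding propagator_Cons using Cons.IH Cons.prems by simp
qed simp

lemma integrable_lebesgue_shift:
  fixes F :: "'a::euclidean_space \<Rightarrow> 'b::{banach, second_countable_topology}"
  assumes "integrable lebesgue F"
  shows "integrable lebesgue (\<lambda>x. F (x - c))"
proof (rule integrable_distr[OF measurable_lebesgue_shift])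
  show "integrable (distr lebesgue lebesgue (\<lambda>y. y - c)) F"
    using assms by (subst distr_lebesgue_shift)
qed

lemma translation_L1: "g \<in> L1 \<Longrightarrow> translation c g \<in> L1"
  unfolding L1_def translation_def mem_Collect_eq by (rule integrable_lebesgue_shift)

lemma translation_L2: "g \<in> L2 \<Longrightarrow> translation c g \<in> L2"
  unfolding L2_def translation_def mem_Collect_eq
  by (intro conjI measurable_lebesgue_compose_shift integrable_lebesgue_shift[of "\<lambda>x. (cmod (g x))\<^sup>2"]) auto

lemma L2_diff:
  assumes "g \<in> L2" "h \<in> L2"
  shows "(\<lambda>x. g x - h x) \<in> L2"
proof -
  have [measurable]: "g \<in> borel_measurable lebesgue" "h \<in> borel_measurable lebesgue"
    and i: "integrable lebesgue (\<lambda>x. (cmod (g x))\<^sup>2)" "integrable lebesgue (\<lambda>x. (cmod (h x))\<^sup>2)"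
    using assms by (auto simp: L2_def)
  have "integrable lebesgue (\<lambda>x. (cmod (g x - h x))\<^sup>2)"
  proof (rule Bochner_Integration.integrable_bound)
    show "integrable lebesgue (\<lambda>x. 2 * (cmod (g x))\<^sup>2 + 2 * (cmod (h x))\<^sup>2)" using i by simp
    show "AE x in lebesgue. norm ((cmod (g x - h x))\<^sup>2) \<le> norm (2 * (cmod (g x))\<^sup>2 + 2 * (cmod (h x))\<^sup>2)"
    proof (rule AE_I2)
      fix x
      have "(cmod (g x - h x))\<^sup>2 \<le> (cmod (g x) + cmod (h x))\<^sup>2"
        by (intro power_mono norm_triangle_ineq4) auto
      also have "\<dots> \<le> 2 * (cmod (g x))\<^sup>2 + 2 * (cmod (h x))\<^sup>2"
        using sum_squares_bound[of "cmod (g x)" "cmod (h x)"] by (simp add: power2_sum)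
      finally show "norm ((cmod (g x - h x))\<^sup>2) \<le> norm (2 * (cmod (g x))\<^sup>2 + 2 * (cmod (h x))\<^sup>2)" by simp
    qed
  qed measurable
  then show ?thesis by (simp add: L2_def)
qed

lemma L2_cmult: "g \<in> L2 \<Longrightarrow> (\<lambda>x. a * g x) \<in> L2"
  unfolding L2_def mem_Collect_eq norm_mult power_mult_distrib
  by (intro conjI borel_measurable_times borel_measurable_const integrable_mult_right) auto

lemma fourier_translation:
  fixes g :: "'a::euclidean_space \<Rightarrow> complex"
  assumes g: "g \<in> L1"
  shows "fourier (translation c g) \<xi> = iexp (- (2 * pi * (c \<bullet> \<xi>))) * fourier g \<xi>"
proof -
  let ?e = "\<lambda>x. exp (- (2 * complex_of_real pi * \<i> * complex_of_real (x \<bullet> \<xi>)))"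
  have [measurable]: "?e \<in> borel_measurable lebesgue"
    by (rule measurable_completion) measurable
  have m: "(\<lambda>x. g x * ?e (x + c)) \<in> borel_measurable lebesgue"
  proof -
    have "(\<lambda>x. ?e (x + c)) \<in> borel_measurable lebesgue"
      by (rule measurable_completion) measurable
    then show ?thesis using L1_measurable[OF g] by measurable
  qed
  have e: "?e (x + c) = iexp (- (2 * pi * (c \<bullet> \<xi>))) * ?e x" for x
    by (simp add: exp_add[symmetric] inner_add_left algebra_simps)
  have "fourier (translation c g) \<xi> = (LINT x|lebesgue. g x * ?e (x + c))"
    using integral_lebesgue_shift[OF m, of c] by (simp add: fourier_def translation_def)
  also have "\<dots> = (LINT x|lebesgue. iexp (- (2 * pi * (c \<bullet> \<xi>))) * (g x * ?e x))"
    unfolding e by (simp only: mult_ac)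
  also have "\<dots> = iexp (- (2 * pi * (c \<bullet> \<xi>))) * fourier g \<xi>"
    unfolding fourier_def by (rule integral_mult_right_zero)
  finally show ?thesis .
qed

lemma fourier_integrable:
  assumes g: "g \<in> L1"
  shows "integrable lebesgue (\<lambda>x. g x * exp (- (2 * of_real pi * \<i> * of_real (x \<bullet> \<xi>))))"
proof (rule Bochner_Integration.integrable_bound)
  show "integrable lebesgue g" using g by (simp add: L1_def)
  have [measurable]: "(\<lambda>x. exp (- (2 * complex_of_real pi * \<i> * complex_of_real (x \<bullet> \<xi>)))) \<in> borel_measurable lebesgue"
    by (rule measurable_completion) measurable
  show "(\<lambda>x. g x * exp (- (2 * of_real pi * \<i> * of_real (x \<bullet> \<xi>)))) \<in> borel_measurable lebesgue"
    using L1_measurable[OF g] by measurable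
qed (simp add: norm_mult)

lemma fourier_diff:
  assumes "g \<in> L1" "h \<in> L1"
  shows "fourier (\<lambda>x. g x - h x) \<xi> = fourier g \<xi> - fourier h \<xi>"
  unfolding fourier_def left_diff_distrib
  by (rule Bochner_Integration.integral_diff) (intro fourier_integrable assms)+

lemma fourier_cmult: "fourier (\<lambda>x. a * g x) \<xi> = a * fourier g \<xi>"
  unfolding fourier_def mult.assoc by (rule integral_mult_right_zero)

lemma convol_cmult: "convol h (\<lambda>x. a * g x) x = a * convol h g x"
  unfolding convol_def by (simp only: mult.left_commute integral_mult_right_zero)

lemma convol_diff:
  assumes "h \<in> L2" "g \<in> L2" "k \<in> L2"
  shows "convol h (\<lambda>x. g x - k x) x = convol h g x - convol h k x"
  unfolding convol_def right_diff_distrib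
  by (rule Bochner_Integration.integral_diff) (intro L2_convol_integrable assms)+

text \<open>The Taylor remainder of order zero of the exponential.\<close>

lemma cmod_one_minus_iexp_le: "cmod (1 - iexp t) \<le> \<bar>t\<bar>"
  using iexp_approx1[of t 0] by (simp add: norm_minus_commute)

section \<open>Translation estimate for a single covering frame\<close>

text \<open>The energy identity of a covering frame holds at every \<xi>, so the bound for finite
  subfamilies does too, and not merely almost everywhere.\<close>

lemma frame_sum_le:
  assumes F: "uniform_covering_frame \<Lambda> g g0" and A: "finite A" "A \<subseteq> \<Lambda>"
  shows "(cmod (fourier g0 \<xi>))\<^sup>2 + (\<Sum>l\<in>A. (cmod (fourier (g l) \<xi>))\<^sup>2) \<le> 1"
proof -
  let ?s = "\<lambda>l. ennreal ((cmod (fourier (g l) \<xi>))\<^sup>2)"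
  have "(\<Sum>l\<in>A. ?s l) \<le> (\<Sum>\<^sub>\<infinity>l\<in>\<Lambda>. ?s l)"
    unfolding nonneg_infsum_complete[of \<Lambda> ?s, OF zero_le] by (rule SUP_upper) (use A in auto)
  then have "ennreal ((cmod (fourier g0 \<xi>))\<^sup>2) + (\<Sum>l\<in>A. ?s l) \<le> ennreal ((cmod (fourier g0 \<xi>))\<^sup>2) + (\<Sum>\<^sub>\<infinity>l\<in>\<Lambda>. ?s l)"
    by (rule add_left_mono)
  also have "\<dots> = 1" using F by (simp add: uniform_covering_frame_def)
  finally have "ennreal ((cmod (fourier g0 \<xi>))\<^sup>2 + (\<Sum>l\<in>A. (cmod (fourier (g l) \<xi>))\<^sup>2)) \<le> ennreal 1"
    by (simp add: sum_nonneg ennreal_plus)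
  then show ?thesis by (subst (asm) ennreal_le_iff) auto
qed

text \<open>The quantitative estimate for one frame; the limit theorem lets \<epsilon> tend to 0
  along the sequence. Positivity of \<epsilon> allows division by it in the filter d.\<close>

lemma scattering_translation_le:
  fixes f :: "'a::euclidean_space \<Rightarrow> complex"
  assumes F: "uniform_covering_frame \<Lambda> g g0" and f: "f \<in> L2" and e: "\<epsilon> > 0"
    and small: "\<And>\<xi>. fourier g0 \<xi> \<noteq> 0 \<Longrightarrow> 2 * pi * (norm c * norm \<xi>) \<le> \<epsilon>"
  shows "L2l2_norm (paths \<Lambda>) (\<lambda>p x. scattering g g0 f p x - scattering g g0 (translation c f) p x)
    \<le> ennreal (\<epsilon> * sqrt (enn2real (sqnorm f)))"
proof -
  have g0: "g0 \<in> L1 \<inter> L2" and g: "\<And>l. l \<in> \<Lambda> \<Longrightarrow> g l \<in> L1 \<inter> L2"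
    using F by (auto simp: uniform_covering_frame_def semi_discrete_bessel_def)
  \<comment> \<open>By \<open>small\<close>, the filter \<open>d\<close> can replace \<open>g0\<close> in the frame without violating the Bessel bound.\<close>
  define D where "D = (\<lambda>x. g0 x - translation c g0 x)"
  define d where "d = (\<lambda>x. of_real (1 / \<epsilon>) * D x)"
  have T: "translation c g0 \<in> L1 \<inter> L2"
    using g0 translation_L1 translation_L2 by blast
  have D: "D \<in> L1 \<inter> L2"
    unfolding D_def using g0 T by (auto intro: L2_diff simp: L1_def)
  then have d: "d \<in> L1 \<inter> L2"
    unfolding d_def using L2_cmult[of D] by (simp only: L1_def Int_iff mem_Collect_eq integrable_mult_right simp_thms)
  have fd: "cmod (fourier d \<xi>) \<le> cmod (fourier g0 \<xi>)" for \<xi>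
  proof (cases "fourier g0 \<xi> = 0")
    case True
    then show ?thesis
      using g0 T unfolding d_def D_def fourier_cmult by (simp add: fourier_diff fourier_translation)
  next
    case False
    let ?t = "- (2 * pi * (c \<bullet> \<xi>))"
    have "\<bar>?t\<bar> = 2 * pi * \<bar>c \<bullet> \<xi>\<bar>" by (simp add: abs_mult)
    also have "\<dots> \<le> 2 * pi * (norm c * norm \<xi>)"
      by (intro mult_left_mono Cauchy_Schwarz_ineq2) auto
    also have "\<dots> \<le> \<epsilon>" by (rule small[OF False])
    finally have t: "cmod (1 - iexp ?t) \<le> \<epsilon>"
      by (rule order_trans[OF cmod_one_minus_iexp_le])
    have "fourier d \<xi> = of_real (1 / \<epsilon>) * ((1 - iexp ?t) * fourier g0 \<xi>)"
      using g0 T unfolding d_def D_def fourier_cmult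
      by (simp only: fourier_diff fourier_translation Int_iff left_diff_distrib mult_1_left)
    then have "cmod (fourier d \<xi>) = (1 / \<epsilon>) * (cmod (1 - iexp ?t) * cmod (fourier g0 \<xi>))"
      using e by (simp only: norm_mult norm_of_real) simp
    also have "\<dots> \<le> (1 / \<epsilon>) * (\<epsilon> * cmod (fourier g0 \<xi>))"
      using e t by (intro mult_left_mono mult_right_mono) auto
    also have "\<dots> = cmod (fourier g0 \<xi>)" using e by simp
    finally show ?thesis .
  qed
  have sum_le: "(cmod (fourier d \<xi>))\<^sup>2 + (\<Sum>l\<in>A. (cmod (fourier (g l) \<xi>))\<^sup>2) \<le> 1"
    if "finite A" "A \<subseteq> \<Lambda>" for A \<xi>
  proof -
    have "(cmod (fourier d \<xi>))\<^sup>2 \<le> (cmod (fourier g0 \<xi>))\<^sup>2" by (intro power_mono fd) simp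
    with frame_sum_le[OF F that, of \<xi>] show ?thesis by linarith
  qed
  have g_le: "cmod (fourier (g l) \<xi>) \<le> 1" if "l \<in> \<Lambda>" for l \<xi>
  proof -
    have "(cmod (fourier d \<xi>))\<^sup>2 + (cmod (fourier (g l) \<xi>))\<^sup>2 \<le> 1"
      using sum_le[of "{l}" \<xi>] that by simp
    then have "(cmod (fourier (g l) \<xi>))\<^sup>2 \<le> 1"
      using zero_le_power2[of "cmod (fourier d \<xi>)"] by linarith
    then show ?thesis by (simp add: abs_square_le_1)
  qed
  have diff: "scattering g g0 f p x - scattering g g0 (translation c f) p x
      = of_real \<epsilon> * convol (propagator g p f) d x" if p: "set p \<subseteq> \<Lambda>" for p x
  proof -
    let ?u = "propagator g p f"
    have g0m: "g0 \<in> borel_measurable lebesgue" using g0 L1_measurable by blast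
    have u: "?u \<in> L2" using p g g_le f by (intro propagator_L2) auto
    have "propagator g p (translation c f) = translation c ?u"
      using p g g_le f by (intro propagator_translation) auto
    then have "scattering g g0 (translation c f) p x = translation c (convol ?u g0) x"
      unfolding scattering_def using convol_translation[OF L2_measurable[OF u] g0m] by simp
    \<comment> \<open>Translating the output amounts to translating the filter, so both terms have
      the same first factor \<open>?u\<close>.\<close>
    also have "\<dots> = convol ?u (translation c g0) x"
      by (simp add: convol_def translation_def algebra_simps)
    finally have "scattering g g0 f p x - scattering g g0 (translation c f) p x = convol ?u D x"
      unfolding scattering_def D_def using convol_diff[OF u] g0 T by simp
    also have "\<dots> = of_real \<epsilon> * convol ?u d x"
      unfolding d_def convol_cmult using e by simp
    finally show ?thesis .
  qed
  have entry: "sqnorm (\<lambda>x. scattering g g0 f p x - scattering g g0 (translation c f) p x)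
      = ennreal (\<epsilon>\<^sup>2) * sqnorm (convol (propagator g p f) d)" if p: "set p \<subseteq> \<Lambda>" for p
  proof -
    have u: "propagator g p f \<in> L2" using p g g_le f by (intro propagator_L2) auto
    have "convol (propagator g p f) d \<in> borel_measurable lebesgue"
      by (rule bessel_at_pair(2)[where A="{}", OF _ d _ _ u]) (use sum_le[of "{}"] in auto)
    then show ?thesis unfolding diff[OF p] by (subst sqnorm_cmult) auto
  qed
  define s where "s = (\<Sum>\<^sub>\<infinity>p\<in>paths \<Lambda>. sqnorm (\<lambda>x. scattering g g0 f p x - scattering g g0 (translation c f) p x))"
  have "s \<le> ennreal (\<epsilon>\<^sup>2) * sqnorm f"
    unfolding s_def
  \<comment> \<open>The infinite sum is the supremum over finite sets of paths. Such a set involves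
    finitely many filters and has bounded length, so it lies in a truncated tree covered by
    \<open>scattering_energy_le\<close>.\<close>
  proof (subst nonneg_infsum_complete, simp, rule SUP_least, clarify)
    fix P assume P: "finite P" "P \<subseteq> paths \<Lambda>"
    define A where "A = (\<Union>p\<in>P. set p)"
    \<comment> \<open>The inserted 0 makes the maximum meaningful when P is empty.\<close>
    define N where "N = Max (insert 0 (length ` P))"
    have P\<Lambda>: "set p \<subseteq> \<Lambda>" if "p \<in> P" for p using P(2) that by (auto simp: paths_def)
    have A: "finite A" "A \<subseteq> \<Lambda>" using P(1) P\<Lambda> by (auto simp: A_def)
    have sub: "P \<subseteq> {p. set p \<subseteq> A \<and> length p \<le> N}"
      using P(1) by (auto simp: A_def N_def)
    have "(\<Sum>p\<in>P. sqnorm (\<lambda>x. scattering g g0 f p x - scattering g g0 (translation c f) p x))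
       = ennreal (\<epsilon>\<^sup>2) * (\<Sum>p\<in>P. sqnorm (convol (propagator g p f) d))"
      unfolding sum_distrib_left by (rule sum.cong[OF refl]) (use entry P\<Lambda> in blast)
    also have "\<dots> \<le> ennreal (\<epsilon>\<^sup>2) * (\<Sum>p\<in>{p. set p \<subseteq> A \<and> length p \<le> N}. sqnorm (convol (propagator g p f) d))"
      by (intro mult_left_mono sum_mono2 sub finite_lists_length_le[OF A(1)]) auto
    also have "\<dots> \<le> ennreal (\<epsilon>\<^sup>2) * sqnorm f"
      by (intro mult_left_mono scattering_energy_le[OF A(1) d _ sum_le[OF A] f]) (use g A(2) in auto)
    finally show "(\<Sum>p\<in>P. sqnorm (\<lambda>x. scattering g g0 f p x - scattering g g0 (translation c f) p x))
      \<le> ennreal (\<epsilon>\<^sup>2) * sqnorm f" .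
  qed
  also have "\<dots> = ennreal (\<epsilon>\<^sup>2 * enn2real (sqnorm f))"
    using f by (simp add: L2_iff_sqnorm ennreal_mult less_top)
  finally have s: "s \<le> ennreal (\<epsilon>\<^sup>2 * enn2real (sqnorm f))" .
  \<comment> \<open>Finiteness selects the square-root branch of \<open>L2l2_norm\<close>.\<close>
  then have fin: "s \<noteq> \<infinity>" by (auto simp: top_unique)
  have "enn2real s \<le> \<epsilon>\<^sup>2 * enn2real (sqnorm f)"
    using s by (intro enn2real_leI) auto
  then have "sqrt (enn2real s) \<le> sqrt (\<epsilon>\<^sup>2 * enn2real (sqnorm f))" by simp
  also have "\<dots> = \<epsilon> * sqrt (enn2real (sqnorm f))" using e by (simp add: real_sqrt_mult)
  finally have "sqrt (enn2real s) \<le> \<epsilon> * sqrt (enn2real (sqnorm f))" .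
  then show ?thesis
    unfolding L2l2_norm_def Let_def sqnorm_def[symmetric] s_def[symmetric]
    using fin by (simp add: ennreal_leI)
qed

theorem corollary4p2:
  fixes \<Lambda> :: "nat \<Rightarrow> 'i set"
    and g :: "nat \<Rightarrow> 'i \<Rightarrow> 'a::euclidean_space \<Rightarrow> complex"
    and g0 :: "nat \<Rightarrow> 'a \<Rightarrow> complex"
    and f :: "'a \<Rightarrow> complex"
    and c :: 'a
  assumes "\<And>J. uniform_covering_frame (\<Lambda> J) (g J) (g0 J)"
    and "coherent \<Lambda> g g0"
    and "f \<in> L2"
  shows "(\<lambda>J. L2l2_norm (paths (\<Lambda> J))
            (\<lambda>p x. scattering (g J) (g0 J) f p x
                  - scattering (g J) (g0 J) (translation c f) p x)) \<longlonglongrightarrow> 0"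
proof -
  define r where "r = (\<lambda>J. Sup {norm \<xi> | \<xi>. fourier (g0 J) \<xi> \<noteq> 0})"
  \<comment> \<open>The summand 1/(J+1) keeps \<epsilon> strictly positive, even for c = 0, and
    vanishes in the limit.\<close>
  define \<epsilon> where "\<epsilon> = (\<lambda>J. 2 * pi * (norm c * r J) + 1 / real (Suc J))"
  have r_lim: "r \<longlonglongrightarrow> 0" using assms(2) by (simp add: coherent_def r_def)
  have r_le: "norm \<xi> \<le> r J" if "fourier (g0 J) \<xi> \<noteq> 0" for J \<xi>
    unfolding r_def
  proof (rule cSup_upper)
    \<comment> \<open>The real supremum is an upper bound only for sets that are bounded above; the
      bounded support of the transform ensures this.\<close>
    obtain R where R: "supp (fourier (g0 J)) \<subseteq> ball 0 R"
      using assms(1)[of J] by (auto simp: uniform_covering_frame_def)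
    have "norm \<eta> \<le> R" if "fourier (g0 J) \<eta> \<noteq> 0" for \<eta>
    proof -
      have "\<eta> \<in> supp (fourier (g0 J))"
        unfolding supp_def by (rule subsetD[OF closure_subset]) (simp add: that)
      then show ?thesis using R by auto
    qed
    then show "bdd_above {norm \<xi> | \<xi>. fourier (g0 J) \<xi> \<noteq> 0}"
      by (intro bdd_aboveI[of _ R]) auto
  qed (use that in auto)
  have r_nonneg: "0 \<le> r J" for J
  proof -
    \<comment> \<open>The transform has modulus 1 at the origin, so 0 is among the norms over which
      the supremum is taken.\<close>
    have "fourier (g0 J) 0 \<noteq> 0"
      using assms(1)[of J] by (auto simp: uniform_covering_frame_def)
    from r_le[OF this] show ?thesis by simp
  qed
  have \<epsilon>_lim: "\<epsilon> \<longlonglongrightarrow> 2 * pi * (norm c * 0) + 0"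
    unfolding \<epsilon>_def using LIMSEQ_Suc[OF lim_const_over_n[of "1::real"]]
    by (intro tendsto_intros r_lim) simp
  have \<epsilon>_pos: "\<epsilon> J > 0" for J
    unfolding \<epsilon>_def by (intro add_nonneg_pos mult_nonneg_nonneg r_nonneg) auto
  have le: "L2l2_norm (paths (\<Lambda> J)) (\<lambda>p x. scattering (g J) (g0 J) f p x
      - scattering (g J) (g0 J) (translation c f) p x) \<le> ennreal (\<epsilon> J * sqrt (enn2real (sqnorm f)))" for J
  proof (rule scattering_translation_le[OF assms(1,3) \<epsilon>_pos])
    fix \<xi> assume "fourier (g0 J) \<xi> \<noteq> 0"
    then have "2 * pi * (norm c * norm \<xi>) \<le> 2 * pi * (norm c * r J)"
      by (intro mult_left_mono r_le) auto
    moreover have "0 \<le> 1 / real (Suc J)" by simp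
    ultimately show "2 * pi * (norm c * norm \<xi>) \<le> \<epsilon> J" unfolding \<epsilon>_def by linarith
  qed
  have lim: "(\<lambda>J. ennreal (\<epsilon> J * sqrt (enn2real (sqnorm f)))) \<longlonglongrightarrow> ennreal 0"
  proof (rule tendsto_ennrealI)
    show "(\<lambda>J. \<epsilon> J * sqrt (enn2real (sqnorm f))) \<longlonglongrightarrow> 0"
      using tendsto_mult_right[OF \<epsilon>_lim, of "sqrt (enn2real (sqnorm f))"] by simp
  qed
  show ?thesis
  proof (rule tendsto_sandwich[OF _ _ tendsto_const])
    show "\<forall>\<^sub>F J in sequentially. 0 \<le> L2l2_norm (paths (\<Lambda> J)) (\<lambda>p x. scattering (g J) (g0 J) f p x
      - scattering (g J) (g0 J) (translation c f) p x)"
      by (rule always_eventually) simp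
    show "\<forall>\<^sub>F J in sequentially. L2l2_norm (paths (\<Lambda> J)) (\<lambda>p x. scattering (g J) (g0 J) f p x
      - scattering (g J) (g0 J) (translation c f) p x) \<le> ennreal (\<epsilon> J * sqrt (enn2real (sqnorm f)))"
      using le by (intro always_eventually allI)
    show "(\<lambda>J. ennreal (\<epsilon> J * sqrt (enn2real (sqnorm f)))) \<longlonglongrightarrow> 0"
      using lim by (simp only: ennreal_0)
  qed
qed

end
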